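(* Let $n\ge3$ be odd and let $\alpha_n=\sigma_1\sigma_2^{-1}\sigma_3\sigma_4^{-1}\cdots\sigma_{n-1}^{(-1)^n}\in B_n$. Then the Ultra Summit Set $U_{BKL}(\alpha_n)$ of $\alpha_n$ in the Birman–Ko–Lee presentation contains at least $2^{(n-1)/2}$ rigid braids (rigid with respect to the Birman–Ko–Lee left normal form).
   Context: $B_n$ is the braid group on $n$ strands with Artin generators $\sigma_1,\dots,\sigma_{n-1}$. For $n\ge t>s\ge1$ the band generator is $(t\ s)=\sigma_{t-1}\sigma_{t-2}\cdots\sigma_s\,\sigma_{s+1}^{-1}\sigma_{s+2}^{-1}\cdots\sigma_{t-1}^{-1}$. For a decreasing sequence $n_1>n_2>\dots>n_m$ the descending cycle is $(n_1\ n_2\ \dots\ n_m)=(n_1\ n_2)(n_2\ n_3)\cdots(n_{m-1}\ n_m)$. The fundamental word is $\delta=(n\ n{-}1\ \dots\ 2\ 1)$. Two descending cycles $(n_1\ \dots\ n_p)$ and $(m_1\ \dots\ m_q)$ are parallel if $(n_i-m_j)(n_i-m_{j+1})(n_{i+1}-m_j)(n_{i+1}-m_{j+1})>0$ for all $i=1,\dots,p-1$, $j=1,\dots,q-1$. A canonical factor is a product of pairwise parallel descending cycles (the empty product $1$ included). Left normal form: every $b\in B_n$ has a unique expression $\delta^k\cdot b_1\cdots b_m$ ($k\in\mathbb Z$, $m\ge0$), where each $b_i$ is a canonical factor different from $1$ and $\delta$, and for every $i=1,\dots,m-1$ and every band generator $(j\ l)$, $j>l$, the braids $b_i\cdot(j\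 l)$ and $(j\ l)^{-1}\cdot b_{i+1}$ are not both canonical factors. Super Summit Set of $b$: the set of conjugates of $b$ having, among all conjugates of $b$, maximal $k$ and minimal $m$ in this left normal form. Cycling: if $b=\delta^kb_1\cdots b_m$ is in left normal form, ${\bf c}(b)=\delta^k\cdot b_2\cdots b_m\cdot(\delta^kb_1\delta^{-k})$ (and ${\bf c}(b)=b$ if $m=0$). Ultra Summit Set $U_{BKL}(b)$: the set of elements $x$ of the Super Summit Set of $b$ with ${\bf c}^d(x)=x$ for some integer $d\ge1$. A braid $b$ is rigid if $\delta^k\cdot b_2\cdots b_m\cdot(\delta^kb_1\delta^{-k})$ is, as written, in left normal form. *)

theory Defs
  imports "HOL-Algebra.Group"
begin

section \<open>The braid group on Artin generators\<close>

text \<open>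
  A letter \<open>(i, True)\<close> stands for the Artin generator with index \<open>i\<close>, and \<open>(i, False)\<close> for its
  inverse.
\<close>

type_synonym braid_word = "(nat \<times> bool) list"

definition braid_words :: "nat \<Rightarrow> braid_word set" where
  "braid_words n = lists ({1..<n} \<times> UNIV)"

inductive braid_eq :: "nat \<Rightarrow> braid_word \<Rightarrow> braid_word \<Rightarrow> bool" for n where
  refl: "w \<in> braid_words n \<Longrightarrow> braid_eq n w w"
| sym: "braid_eq n u v \<Longrightarrow> braid_eq n v u"
| trans: "braid_eq n u v \<Longrightarrow> braid_eq n v w \<Longrightarrow> braid_eq n u w"
| cong: "braid_eq n u v \<Longrightarrow> x \<in> braid_words n \<Longrightarrow> y \<in> braid_words n \<Longrightarrow>
    braid_eq n (x @ u @ y) (x @ v @ y)"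
| cancel: "1 \<le> i \<Longrightarrow> i < n \<Longrightarrow> braid_eq n [(i, e), (i, \<not> e)] []"
| far: "1 \<le> i \<Longrightarrow> i + 2 \<le> j \<Longrightarrow> j < n \<Longrightarrow>
    braid_eq n [(i, True), (j, True)] [(j, True), (i, True)]"
| braid: "1 \<le> i \<Longrightarrow> i + 1 < n \<Longrightarrow>
    braid_eq n [(i, True), (i + 1, True), (i, True)] [(i + 1, True), (i, True), (i + 1, True)]"

definition braid_rel :: "nat \<Rightarrow> (braid_word \<times> braid_word) set" where
  "braid_rel n = {(u, v). braid_eq n u v}"

type_synonym braid = "braid_word set"

definition braid_of :: "nat \<Rightarrow> braid_word \<Rightarrow> braid" where
  "braid_of n w = braid_rel n `` {w}"

definition braid_group :: "nat \<Rightarrow> braid monoid" where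
  "braid_group n =
    \<lparr>carrier = braid_words n // braid_rel n,
     mult = (\<lambda>a b. \<Union>u\<in>a. \<Union>v\<in>b. braid_of n (u @ v)),
     one = braid_of n []\<rparr>"

lemma braid_eq_words:
  "braid_eq n u v \<Longrightarrow> u \<in> braid_words n \<and> v \<in> braid_words n"
  by (induction rule: braid_eq.induct) (auto simp: braid_words_def)

lemma equiv_braid_rel: "equiv (braid_words n) (braid_rel n)"
proof (rule equivI)
  show "braid_rel n \<subseteq> braid_words n \<times> braid_words n"
    using braid_eq_words by (auto simp: braid_rel_def)
  show "refl_on (braid_words n) (braid_rel n)"
    by (auto simp: refl_on_def braid_rel_def intro: braid_eq.refl)
  show "Relation.sym (braid_rel n)"
    by (auto simp: Relation.sym_def braid_rel_def intro: braid_eq.sym)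
  show "Relation.trans (braid_rel n)"
    by (auto simp: Relation.trans_def braid_rel_def intro: braid_eq.trans)
qed

lemma braid_of_eq_iff:
  "u \<in> braid_words n \<Longrightarrow> v \<in> braid_words n \<Longrightarrow> braid_of n u = braid_of n v \<longleftrightarrow> braid_eq n u v"
  unfolding braid_of_def using eq_equiv_class_iff[OF equiv_braid_rel, of u n v]
  by (simp add: braid_rel_def)

lemma braid_words_append [simp]:
  "u @ v \<in> braid_words n \<longleftrightarrow> u \<in> braid_words n \<and> v \<in> braid_words n"
  by (auto simp: braid_words_def)

lemma braid_words_Nil [simp]: "[] \<in> braid_words n"
  by (simp add: braid_words_def)

lemma braid_eq_append:
  assumes "braid_eq n u u'" "braid_eq n v v'"
  shows "braid_eq n (u @ v) (u' @ v')"
proof -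
  have "braid_eq n (u @ v) (u' @ v)"
    using braid_eq.cong[OF assms(1), of "[]" v] braid_eq_words[OF assms(2)] by simp
  moreover have "braid_eq n (u' @ v) (u' @ v')"
    using braid_eq.cong[OF assms(2), of u' "[]"] braid_eq_words[OF assms(1)] by simp
  ultimately show ?thesis by (rule braid_eq.trans)
qed

lemma carrier_braid_group: "carrier (braid_group n) = braid_of n ` braid_words n"
  by (auto simp: braid_group_def braid_of_def quotient_def)

lemma one_braid_group: "\<one>\<^bsub>braid_group n\<^esub> = braid_of n []"
  by (simp add: braid_group_def)

lemma mult_braid_of:
  assumes "u \<in> braid_words n" "v \<in> braid_words n"
  shows "braid_of n u \<otimes>\<^bsub>braid_group n\<^esub> braid_of n v = braid_of n (u @ v)"
proof -
  have "braid_of n (u' @ v') = braid_of n (u @ v)"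
    if "u' \<in> braid_of n u" "v' \<in> braid_of n v" for u' v'
  proof -
    have "braid_eq n u u'" "braid_eq n v v'"
      using that by (auto simp: braid_of_def braid_rel_def)
    then have "braid_eq n (u @ v) (u' @ v')" by (rule braid_eq_append)
    then show ?thesis
      using braid_of_eq_iff braid_eq_words braid_eq.sym by metis
  qed
  moreover have "u \<in> braid_of n u" "v \<in> braid_of n v"
    using assms by (auto simp: braid_of_def braid_rel_def intro: braid_eq.refl)
  ultimately show ?thesis
    unfolding braid_group_def monoid.simps by blast
qed

lemma braid_word_inverse:
  assumes "w \<in> braid_words n"
  shows "\<exists>v\<in>braid_words n. braid_eq n (v @ w) []"
  using assms
proof (induction w)
  case Nil
  have "braid_eq n ([] @ []) []" by (simp add: braid_eq.refl)
  then show ?case using braid_words_Nil by blast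
next
  case (Cons a w)
  obtain i e where a: "a = (i, e)" by fastforce
  have w: "w \<in> braid_words n" and i: "1 \<le> i" "i < n"
    using Cons.prems a by (auto simp: braid_words_def)
  obtain v where v: "v \<in> braid_words n" "braid_eq n (v @ w) []"
    using Cons.IH w by blast
  have "braid_eq n (v @ [(i, \<not> e), (i, \<not> \<not> e)] @ w) (v @ [] @ w)"
    using braid_eq.cong[OF braid_eq.cancel[OF i, of "\<not> e"] v(1) w] by simp
  then have "braid_eq n ((v @ [(i, \<not> e)]) @ a # w) (v @ w)"
    by (simp add: a)
  then have "braid_eq n ((v @ [(i, \<not> e)]) @ a # w) []"
    using v(2) by (rule braid_eq.trans)
  moreover have "v @ [(i, \<not> e)] \<in> braid_words n"
    using v(1) i by (auto simp: braid_words_def)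
  ultimately show ?case by blast
qed

theorem group_braid_group: "group (braid_group n)"
proof (rule groupI)
  fix x assume "x \<in> carrier (braid_group n)"
  then obtain w where w: "w \<in> braid_words n" "x = braid_of n w"
    by (auto simp: carrier_braid_group)
  then obtain v where v: "v \<in> braid_words n" "braid_eq n (v @ w) []"
    using braid_word_inverse by blast
  then have "braid_of n v \<otimes>\<^bsub>braid_group n\<^esub> x = \<one>\<^bsub>braid_group n\<^esub>"
    using w by (simp add: mult_braid_of one_braid_group braid_of_eq_iff)
  then show "\<exists>y\<in>carrier (braid_group n). y \<otimes>\<^bsub>braid_group n\<^esub> x = \<one>\<^bsub>braid_group n\<^esub>"
    using v(1) by (auto simp: carrier_braid_group)
qed (auto simp: carrier_braid_group one_braid_group mult_braid_of)

definition braid_prod :: "nat \<Rightarrow> braid list \<Rightarrow> braid" where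
  "braid_prod n bs = foldr (mult (braid_group n)) bs \<one>\<^bsub>braid_group n\<^esub>"

definition conjugates :: "nat \<Rightarrow> braid \<Rightarrow> braid set" where
  "conjugates n b =
    {g \<otimes>\<^bsub>braid_group n\<^esub> b \<otimes>\<^bsub>braid_group n\<^esub> inv\<^bsub>braid_group n\<^esub> g | g. g \<in> carrier (braid_group n)}"

section \<open>The Birman--Ko--Lee presentation\<close>

text \<open>The band generator \<open>(t s)\<close>, meant for \<open>n \<ge> t > s \<ge> 1\<close>.\<close>

definition band :: "nat \<Rightarrow> nat \<Rightarrow> nat \<Rightarrow> braid" where
  "band n t s =
    braid_of n (map (\<lambda>i. (i, True)) (rev [s..<t]) @ map (\<lambda>i. (i, False)) [s + 1..<t])"

text \<open>Descending cycles are written as lists; a list of length at most 1 denotes the trivial braid.\<close>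

definition descending :: "nat \<Rightarrow> nat list \<Rightarrow> bool" where
  "descending n c \<longleftrightarrow> set c \<subseteq> {1..n} \<and> sorted_wrt (>) c"

definition descending_cycle :: "nat \<Rightarrow> nat list \<Rightarrow> braid" where
  "descending_cycle n c = braid_prod n (map (\<lambda>(t, s). band n t s) (zip c (tl c)))"

definition delta :: "nat \<Rightarrow> braid" where
  "delta n = descending_cycle n (rev [1..<n + 1])"

definition parallel :: "nat list \<Rightarrow> nat list \<Rightarrow> bool" where
  "parallel c d \<longleftrightarrow>
    (\<forall>i j. i + 1 < length c \<longrightarrow> j + 1 < length d \<longrightarrow>
      (int (c ! i) - int (d ! j)) * (int (c ! i) - int (d ! (j + 1))) *
      (int (c ! (i + 1)) - int (d ! j)) * (int (c ! (i + 1)) - int (d ! (j + 1))) > 0)"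

text \<open>
  As \<^const>\<open>parallel\<close> is symmetric, \<^const>\<open>sorted_wrt\<close> expresses that the cycles at any two distinct
  positions of the list are parallel.
\<close>

definition canonical_factors :: "nat \<Rightarrow> braid set" where
  "canonical_factors n =
    {braid_prod n (map (descending_cycle n) cs) | cs.
      (\<forall>c\<in>set cs. descending n c) \<and> sorted_wrt parallel cs}"

section \<open>Left normal form, cycling, summit sets\<close>

text \<open>The formal expression with exponent \<open>k\<close> and list of factors \<open>bs\<close> is in left normal form.\<close>

definition left_normal :: "nat \<Rightarrow> int \<Rightarrow> braid list \<Rightarrow> bool" where
  "left_normal n k bs \<longleftrightarrow>
    (\<forall>b\<in>set bs. b \<in> canonical_factors n \<and> b \<noteq> \<one>\<^bsub>braid_group n\<^esub> \<and> b \<noteq> delta n) \<and>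
    (\<forall>i j l. i + 1 < length bs \<longrightarrow> 1 \<le> l \<longrightarrow> l < j \<longrightarrow> j \<le> n \<longrightarrow>
      \<not> (bs ! i \<otimes>\<^bsub>braid_group n\<^esub> band n j l \<in> canonical_factors n \<and>
         inv\<^bsub>braid_group n\<^esub> (band n j l) \<otimes>\<^bsub>braid_group n\<^esub> bs ! (i + 1) \<in> canonical_factors n))"

definition normal_form_value :: "nat \<Rightarrow> int \<Rightarrow> braid list \<Rightarrow> braid" where
  "normal_form_value n k bs = delta n [^]\<^bsub>braid_group n\<^esub> k \<otimes>\<^bsub>braid_group n\<^esub> braid_prod n bs"

text \<open>
  Every braid has exactly one left normal form, so the following relation between \<open>b\<close> and \<open>(k, bs)\<close>
  is the graph of a function of \<open>b\<close>. Everything below is phrased through this relation, which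
  avoids a choice operator.
\<close>

definition has_left_normal_form :: "nat \<Rightarrow> braid \<Rightarrow> int \<Rightarrow> braid list \<Rightarrow> bool" where
  "has_left_normal_form n b k bs \<longleftrightarrow> left_normal n k bs \<and> b = normal_form_value n k bs"

fun cycle_factors :: "nat \<Rightarrow> int \<Rightarrow> braid list \<Rightarrow> braid list" where
  "cycle_factors n k [] = []"
| "cycle_factors n k (b # bs) =
    bs @ [delta n [^]\<^bsub>braid_group n\<^esub> k \<otimes>\<^bsub>braid_group n\<^esub> b \<otimes>\<^bsub>braid_group n\<^esub>
          delta n [^]\<^bsub>braid_group n\<^esub> (- k)]"

text \<open>\<open>cycling n x y\<close> means that \<open>y\<close> is the result of cycling \<open>x\<close>.\<close>

definition cycling :: "nat \<Rightarrow> braid \<Rightarrow> braid \<Rightarrow> bool" where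
  "cycling n x y \<longleftrightarrow>
    (\<exists>k bs. has_left_normal_form n x k bs \<and> y = normal_form_value n k (cycle_factors n k bs))"

definition super_summit_set :: "nat \<Rightarrow> braid \<Rightarrow> braid set" where
  "super_summit_set n b =
    {x \<in> conjugates n b. \<exists>k bs. has_left_normal_form n x k bs \<and>
      (\<forall>y\<in>conjugates n b. \<forall>k' bs'. has_left_normal_form n y k' bs' \<longrightarrow>
        k' \<le> k \<and> length bs \<le> length bs')}"

definition ultra_summit_set :: "nat \<Rightarrow> braid \<Rightarrow> braid set" where
  "ultra_summit_set n b = {x \<in> super_summit_set n b. \<exists>d\<ge>1. (cycling n ^^ d) x x}"

definition rigid :: "nat \<Rightarrow> braid \<Rightarrow> bool" where
  "rigid n b \<longleftrightarrow>
    (\<exists>k bs. has_left_normal_form n b k bs \<and> left_normal n k (cycle_factors n k bs))"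

definition alpha :: "nat \<Rightarrow> braid" where
  "alpha n = braid_of n (map (\<lambda>i. (i, odd i)) [1..<n])"

end

theory Submission
  imports Defs "HOL-Combinatorics.Transposition"
begin

text \<open>
  Label the punctures as the vertices of a convex \<open>n\<close>-gon, so that a band generator
  \<open>(t s)\<close> is the half twist along the chord from \<open>t\<close> to \<open>s\<close>.
  As \<open>n\<close> is odd, a Hamiltonian path of the polygon has an even number of edges. Take
  one that does not cross itself, let \<open>P\<close> be the product of the half twists along its
  first, third, fifth, ... edges and \<open>N\<close> the product for the remaining edges. Both sets
  of edges consist of disjoint noncrossing chords, so \<open>P\<close> and \<open>N\<close> are
  canonical factors. For the path \<open>1, 2, ..., n\<close> the braid \<open>P
  N\<^sup>-\<^sup>1\<close> is a reordering of \<open>alpha n\<close>, and a standard argument on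
  Coxeter elements of a tree shows that it is conjugate to \<open>alpha n\<close>
  (\<open>alpha_conjugate_reordered\<close>). Rotating a tail of the path inside its own convex hull
  is conjugation by the fundamental word of a smaller braid group, and this moves the straight path
  to many others (\<open>straighten_path\<close>): starting at \<open>1\<close>, the unvisited
  vertices always form an interval, the next pair of edges goes either to its two lowest vertices,
  or to its highest vertex and from there to its lowest one. This gives \<open>2 ^ ((n - 1) div
  2)\<close> paths.

  Write \<open>star X = X\<^sup>-\<^sup>1 \<delta>\<close> for the complement of a canonical factor.
  The braid attached to a path is \<open>\<delta>\<^sup>-\<^sup>1 P (star N) =
  \<delta>\<^sup>-\<^sup>1 (P N\<^sup>-\<^sup>1) \<delta>\<close>. Since complements of canonical
  factors are canonical (\<open>star_canonical\<close>), two canonical factors \<open>X, Y\<close>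
  are in left normal position as soon as no band generator divides both \<open>star X\<close> and
  \<open>Y\<close>. For the pair \<open>P, star N\<close> and for the pair \<open>star N,
  \<delta>\<^sup>-\<^sup>1 P \<delta>\<close> produced by cycling, this means, after a rotation in
  the second case, that \<open>star P, star N\<close> and \<open>N, P\<close> have no common band
  divisor. Divisibility is read off from permutations (\<open>canonical_divisor_invariant\<close>):
  if \<open>(t s)\<close> divides a canonical factor, then \<open>t\<close> and \<open>s\<close> lie
  in the same cycle of its permutation. Hence a band dividing \<open>P\<close> is an edge of
  \<open>P\<close>, and \<open>P\<close> and \<open>N\<close> share no edge; and a band \<open>(j
  l)\<close> dividing both \<open>star P\<close> and \<open>star N\<close> would make the set of
  vertices \<open>l, ..., j - 1\<close> closed under all edges of the path, against its
  connectedness. So the braid is rigid. Cycling it twice is conjugation by \<open>\<delta>\<close>,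
  whose \<open>n\<close>-th power is central, so the braid returns to itself under cycling.

  That these braids lie in the super summit set needs only the exponent sum: \<open>alpha n\<close>
  is a nontrivial braid with exponent sum \<open>0\<close>, while \<open>\<delta>\<close> has
  exponent sum \<open>n - 1\<close> and a proper canonical factor strictly between \<open>0\<close>
  and \<open>n - 1\<close>. So every normal form of a conjugate has a negative power of
  \<open>\<delta>\<close> and at least two factors (\<open>normal_form_bounds\<close>), and the
  braids above attain both bounds. Finally, the permutation of \<open>P N\<^sup>-\<^sup>1\<close> is
  an \<open>n\<close>-cycle from which the path can be read off, so different paths give different
  braids (\<open>path_braid_inj\<close>).
\<close>

section \<open>Permutation and exponent sum of a braid\<close>

definition word_perm :: "braid_word \<Rightarrow> nat \<Rightarrow> nat" where
  "word_perm w = foldr (\<lambda>(i, _) f. transpose i (Suc i) \<circ> f) w id"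

definition word_expo :: "braid_word \<Rightarrow> int" where
  "word_expo w = (\<Sum>(_, e)\<leftarrow>w. if e then 1 else - 1)"

lemma word_perm_simps [simp]:
  "word_perm [] = id"
  "word_perm ((i, e) # w) = transpose i (Suc i) \<circ> word_perm w"
  by (simp_all add: word_perm_def)

lemma word_perm_append [simp]: "word_perm (u @ v) = word_perm u \<circ> word_perm v"
  by (induction u) (auto simp: o_assoc)

lemma word_expo_simps [simp]:
  "word_expo [] = 0"
  "word_expo ((i, e) # w) = (if e then 1 else - 1) + word_expo w"
  "word_expo (u @ v) = word_expo u + word_expo v"
  by (simp_all add: word_expo_def)

lemma braid_eq_invariants:
  "braid_eq n u v \<Longrightarrow> word_perm u = word_perm v \<and> word_expo u = word_expo v"
proof (induction rule: braid_eq.induct)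
  case (far i j)
  then show ?case by (auto simp: fun_eq_iff transpose_def)
next
  case (braid i)
  then show ?case by (auto simp: fun_eq_iff transpose_def)
qed (auto simp: fun_eq_iff)

text \<open>
  The permutation and the exponent sum are the only two invariants of braids that the argument uses;
  both are constant on the class, so any representative may be chosen.
\<close>

definition perm :: "braid \<Rightarrow> nat \<Rightarrow> nat" where
  "perm b = word_perm (SOME w. w \<in> b)"

definition expo :: "braid \<Rightarrow> int" where
  "expo b = word_expo (SOME w. w \<in> b)"

lemma braid_of_invariants:
  assumes "w \<in> braid_words n"
  shows "perm (braid_of n w) = word_perm w" "expo (braid_of n w) = word_expo w"
proof -
  have "w \<in> braid_of n w"
    using assms by (auto simp: braid_of_def braid_rel_def intro: braid_eq.refl)
  then have "(SOME v. v \<in> braid_of n w) \<in> braid_of n w"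
    by (rule someI)
  then have "braid_eq n w (SOME v. v \<in> braid_of n w)"
    by (simp add: braid_of_def braid_rel_def)
  then show "perm (braid_of n w) = word_perm w" "expo (braid_of n w) = word_expo w"
    using braid_eq_invariants unfolding perm_def expo_def by metis+
qed

section \<open>Noncrossing chords and parallel cycles\<close>

definition chords :: "nat list \<Rightarrow> (nat \<times> nat) list" where
  "chords c = zip c (tl c)"

text \<open>
  The sign condition that defines parallelism, for a single pair of chords; it also forces the four
  endpoints to be distinct.
\<close>

definition noncrossing :: "nat \<times> nat \<Rightarrow> nat \<times> nat \<Rightarrow> bool" where
  "noncrossing = (\<lambda>(t, s) (u, v).
    (int t - int u) * (int t - int v) * (int s - int u) * (int s - int v) > 0)"

lemma noncrossing_cases:
  assumes "noncrossing (t, s) (u, v)" "s < t" "v < u"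
  obtains "t < v" | "u < s" | "v < s" "t < u" | "s < v" "u < t"
  using assms by (auto simp: noncrossing_def zero_less_mult_iff mult_less_0_iff)

lemma noncrossing_iff:
  assumes "s < t" "v < u"
  shows "noncrossing (t, s) (u, v) \<longleftrightarrow>
    t < v \<or> u < s \<or> (v < s \<and> t < u) \<or> (s < v \<and> u < t)"
proof
  assume "noncrossing (t, s) (u, v)"
  then show "t < v \<or> u < s \<or> (v < s \<and> t < u) \<or> (s < v \<and> u < t)"
    using assms by (elim noncrossing_cases) auto
next
  have *: "a * b > 0 \<Longrightarrow> c * d > 0 \<Longrightarrow> a * b * c * d > 0" for a b c d :: int
    using mult_pos_pos[of "a * b" "c * d"] by (simp add: mult.assoc)
  have **: "a * b < 0 \<Longrightarrow> c * d < 0 \<Longrightarrow> a * b * c * d > 0" for a b c d :: int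
    using mult_neg_neg[of "a * b" "c * d"] by (simp add: mult.assoc)
  assume "t < v \<or> u < s \<or> (v < s \<and> t < u) \<or> (s < v \<and> u < t)"
  then have "(int t - int u) * (int t - int v) * (int s - int u) * (int s - int v) > 0"
  proof (elim disjE conjE)
    assume "t < v"
    then show ?thesis using assms by (intro * mult_neg_neg) auto
  next
    assume "u < s"
    then show ?thesis using assms by (intro * mult_pos_pos) auto
  next
    assume "v < s" "t < u"
    then show ?thesis using assms by (intro ** mult_neg_pos) auto
  next
    assume "s < v" "u < t"
    then show ?thesis using assms
      by (intro * mult_pos_pos[of "int t - int u"] mult_neg_neg) auto
  qed
  then show "noncrossing (t, s) (u, v)" by (simp add: noncrossing_def)
qed

lemma noncrossing_commute: "noncrossing p q \<longleftrightarrow> noncrossing q p"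
proof -
  have *: "noncrossing q p" if "noncrossing p q" for p q
  proof -
    obtain t s u v where pq: "p = (t, s)" "q = (u, v)" by fastforce
    have "(int u - int t) * (int u - int s) * (int v - int t) * (int v - int s) =
      (int t - int u) * (int t - int v) * (int s - int u) * (int s - int v)"
      by (simp add: algebra_simps)
    then show ?thesis using that by (simp add: pq noncrossing_def)
  qed
  show ?thesis using * by blast
qed

lemma chords_Cons [simp]: "chords [] = []" "chords [x] = []"
  "chords (x # y # zs) = (x, y) # chords (y # zs)"
  by (simp_all add: chords_def)

lemma chords_append: "chords (A @ x # C) = chords (A @ [x]) @ chords (x # C)"
proof (induction A)
  case (Cons a A)
  then show ?case by (cases A) auto
qed simp

lemma chords_subset: "(t, s) \<in> set (chords c) \<Longrightarrow> t \<in> set c \<and> s \<in> set c"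
  unfolding chords_def by (cases c) (auto dest: set_zip_leftD set_zip_rightD)

lemma chords_descending:
  "sorted_wrt (>) c \<Longrightarrow> (t, s) \<in> set (chords c) \<Longrightarrow> s < t"
proof (induction c)
  case (Cons a c)
  then show ?case by (cases c) auto
qed simp

lemma parallel_iff_chords:
  "parallel c d \<longleftrightarrow> (\<forall>p\<in>set (chords c). \<forall>q\<in>set (chords d). noncrossing p q)"
proof -
  have "p \<in> set (chords c) \<longleftrightarrow> (\<exists>i. i + 1 < length c \<and> p = (c ! i, c ! (i + 1)))" for p c
    by (cases c) (auto simp: chords_def set_zip)
  then have *: "(\<forall>p\<in>set (chords c). Q p) \<longleftrightarrow> (\<forall>i. i + 1 < length c \<longrightarrow> Q (c ! i, c ! (i + 1)))"
    for c and Q :: "nat \<times> nat \<Rightarrow> bool"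
    by (simp only: Ball_def) blast
  show ?thesis
    unfolding parallel_def * noncrossing_def by auto
qed

lemma parallel_commute: "parallel c d \<longleftrightarrow> parallel d c"
  unfolding parallel_iff_chords using noncrossing_commute by blast

lemma sign_trans:
  fixes x y z :: int
  shows "x * y > 0 \<Longrightarrow> y * z > 0 \<Longrightarrow> x * z > 0"
  by (auto simp: zero_less_mult_iff)

text \<open>
  The vertices of \<open>c\<close> are joined to each other by chords that do not meet the chord
  \<open>(u, v)\<close>, so they all lie on the same side of it. This turns the condition on
  consecutive entries into one on arbitrary pairs, which survives passing to a sublist.
\<close>

lemma chord_side_constant:
  assumes "\<forall>p\<in>set (chords c). noncrossing p (u, v)" "length c \<ge> 2" "x \<in> set c" "y \<in> set c"
  shows "noncrossing (x, y) (u, v)"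
proof -
  define g where "g z = (int z - int u) * (int z - int v)" for z :: nat
  have nc: "noncrossing (a, b) (u, v) \<longleftrightarrow> g a * g b > 0" for a b
    by (simp add: noncrossing_def g_def mult.assoc)
  have "\<forall>x\<in>set c. g x * g (hd c) > 0"
    if "\<forall>(a, b)\<in>set (chords c). g a * g b > 0" "length c \<ge> 2" for c
    using that
  proof (induction c)
    case (Cons a c)
    then obtain b d where c: "c = b # d" by (cases c) auto
    have ab: "g a * g b > 0" using Cons.prems by (simp add: c)
    have aa: "g a * g a > 0" "g b * g b > 0" using ab by (auto simp: zero_less_mult_iff)
    have "\<forall>x\<in>set c. g x * g b > 0"
    proof (cases d)
      case Nil
      then show ?thesis using aa c by simp
    next
      case (Cons)
      then have "\<forall>x\<in>set c. g x * g (hd c) > 0"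
        by (intro Cons.IH) (use Cons.prems c in auto)
      then show ?thesis by (simp add: c)
    qed
    then have "\<forall>x\<in>set c. g x * g a > 0"
      using ab sign_trans[of _ "g b" "g a"] by (simp add: mult.commute)
    then show ?case using aa by simp
  qed simp
  moreover have "\<forall>(a, b)\<in>set (chords c). g a * g b > 0"
    using assms(1) nc by auto
  ultimately have "\<forall>x\<in>set c. g x * g (hd c) > 0"
    using assms(2) by blast
  then have "g x * g y > 0"
    using assms(3,4) sign_trans[of "g x" "g (hd c)" "g y"] by (simp add: mult.commute)
  then show ?thesis by (simp add: nc)
qed

lemma parallel_sublist:
  assumes "parallel c d" "set c' \<subseteq> set c" "distinct c'"
  shows "parallel c' d"
proof -
  have "noncrossing p q" if p: "p \<in> set (chords c')" and q: "q \<in> set (chords d)" for p q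
  proof -
    obtain t s u v where pq: "p = (t, s)" "q = (u, v)" by fastforce
    have "length c' \<ge> 2" using p by (cases c' rule: remdups_adj.cases) auto
    then have "length c \<ge> 2"
      using assms(2,3) by (metis card_mono card_length distinct_card le_trans List.finite_set)
    then show ?thesis
      using chord_side_constant[of c u v t s] chords_subset[of t s c'] assms p q
      by (auto simp: pq parallel_iff_chords)
  qed
  then show ?thesis by (auto simp: parallel_iff_chords)
qed

section \<open>Conjugation and commutation in the braid group\<close>

locale braid = fixes n :: nat assumes n_ge_2: "2 \<le> n"
begin

sublocale group "braid_group n" by (rule group_braid_group)

abbreviation B :: "braid set" where "B \<equiv> carrier (braid_group n)"
abbreviation mul :: "braid \<Rightarrow> braid \<Rightarrow> braid" (infixl "\<cdot>" 70) where
  "x \<cdot> y \<equiv> x \<otimes>\<^bsub>braid_group n\<^esub> y"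
abbreviation bone :: braid ("\<e>") where "\<e> \<equiv> \<one>\<^bsub>braid_group n\<^esub>"
abbreviation binv :: "braid \<Rightarrow> braid" ("\<i>") where "\<i> x \<equiv> inv\<^bsub>braid_group n\<^esub> x"

definition comm :: "braid \<Rightarrow> braid \<Rightarrow> bool" where
  "comm x y \<longleftrightarrow> x \<cdot> y = y \<cdot> x"

definition conj_by :: "braid \<Rightarrow> braid \<Rightarrow> braid" where
  "conj_by g x = g \<cdot> x \<cdot> \<i> g"

lemma comm_sym: "comm x y \<Longrightarrow> comm y x"
  by (simp add: comm_def)

lemma comm_mult:
  "comm x y \<Longrightarrow> comm x z \<Longrightarrow> x \<in> B \<Longrightarrow> y \<in> B \<Longrightarrow> z \<in> B \<Longrightarrow> comm x (y \<cdot> z)"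
  unfolding comm_def by (metis m_assoc)

lemma comm_one: "x \<in> B \<Longrightarrow> comm x \<e>"
  by (simp add: comm_def)

lemma comm_inv: "comm x y \<Longrightarrow> x \<in> B \<Longrightarrow> y \<in> B \<Longrightarrow> comm x (\<i> y)"
  unfolding comm_def by (metis inv_closed inv_solve_left inv_solve_right m_assoc m_closed)

lemma comm_cancel:
  "x \<in> B \<Longrightarrow> y \<in> B \<Longrightarrow> z \<in> B \<Longrightarrow> comm x y \<Longrightarrow> x \<cdot> (y \<cdot> z) = y \<cdot> (x \<cdot> z)"
  unfolding comm_def by (metis m_assoc)

lemma conj_closed [simp]: "g \<in> B \<Longrightarrow> x \<in> B \<Longrightarrow> conj_by g x \<in> B"
  by (simp add: conj_by_def)

lemma cancel_left [simp]:
  "g \<in> B \<Longrightarrow> x \<in> B \<Longrightarrow> \<i> g \<cdot> (g \<cdot> x) = x"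
  "g \<in> B \<Longrightarrow> x \<in> B \<Longrightarrow> g \<cdot> (\<i> g \<cdot> x) = x"
  by (simp_all add: m_assoc[symmetric])

lemma conj_mult: "g \<in> B \<Longrightarrow> x \<in> B \<Longrightarrow> y \<in> B \<Longrightarrow> conj_by g (x \<cdot> y) = conj_by g x \<cdot> conj_by g y"
  by (simp add: conj_by_def m_assoc)

lemma conj_inv: "g \<in> B \<Longrightarrow> x \<in> B \<Longrightarrow> conj_by g (\<i> x) = \<i> (conj_by g x)"
  by (simp add: conj_by_def m_assoc inv_mult_group)

lemma conj_conj: "g \<in> B \<Longrightarrow> h \<in> B \<Longrightarrow> x \<in> B \<Longrightarrow> conj_by g (conj_by h x) = conj_by (g \<cdot> h) x"
  by (simp add: conj_by_def m_assoc inv_mult_group)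

lemma conj_one [simp]: "g \<in> B \<Longrightarrow> conj_by g \<e> = \<e>"
  by (simp add: conj_by_def)

lemma conj_comm: "g \<in> B \<Longrightarrow> x \<in> B \<Longrightarrow> comm g x \<Longrightarrow> conj_by g x = x"
  by (simp add: conj_by_def comm_def m_assoc)

lemma conj_eq_iff: "g \<in> B \<Longrightarrow> x \<in> B \<Longrightarrow> y \<in> B \<Longrightarrow> conj_by g x = y \<longleftrightarrow> g \<cdot> x = y \<cdot> g"
  unfolding conj_by_def by (metis inv_closed inv_solve_right m_closed)

definition conjugate :: "braid \<Rightarrow> braid \<Rightarrow> bool" where
  "conjugate x y \<longleftrightarrow> (\<exists>g\<in>B. y = conj_by g x)"

lemma conjugate_trans: "x \<in> B \<Longrightarrow> conjugate x y \<Longrightarrow> conjugate y z \<Longrightarrow> conjugate x z"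
  unfolding conjugate_def using conj_conj by (metis m_closed)

lemma conjugate_iff: "y \<in> conjugates n x \<longleftrightarrow> conjugate x y"
  by (auto simp: conjugates_def conjugate_def conj_by_def)

definition gen :: "nat \<Rightarrow> braid" where "gen i = braid_of n [(i, True)]"

lemma braid_words_Cons [simp]:
  "(i, e) # w \<in> braid_words n \<longleftrightarrow> 1 \<le> i \<and> i < n \<and> w \<in> braid_words n"
  by (auto simp: braid_words_def)

lemma braid_of_closed [simp]: "w \<in> braid_words n \<Longrightarrow> braid_of n w \<in> B"
  by (simp add: carrier_braid_group)

lemma gen_closed [simp]: "1 \<le> i \<Longrightarrow> i < n \<Longrightarrow> gen i \<in> B"
  by (simp add: gen_def)

lemma braid_of_Nil: "braid_of n [] = \<e>"
  by (simp add: one_braid_group)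

lemma braid_of_append:
  "u \<in> braid_words n \<Longrightarrow> v \<in> braid_words n \<Longrightarrow> braid_of n (u @ v) = braid_of n u \<cdot> braid_of n v"
  by (simp add: mult_braid_of)

lemma braid_of_False: "1 \<le> i \<Longrightarrow> i < n \<Longrightarrow> braid_of n [(i, False)] = \<i> (gen i)"
proof -
  assume i: "1 \<le> i" "i < n"
  have "braid_eq n [(i, False), (i, True)] []" using braid_eq.cancel[OF i, of False] by simp
  then have "braid_of n [(i, False)] \<cdot> gen i = \<e>"
    using i by (simp add: gen_def mult_braid_of one_braid_group braid_of_eq_iff)
  then show ?thesis using i by (simp add: inv_equality)
qed

lemma gen_far: "1 \<le> i \<Longrightarrow> i + 2 \<le> j \<Longrightarrow> j < n \<Longrightarrow> comm (gen i) (gen j)"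
  unfolding comm_def gen_def
  by (simp add: mult_braid_of braid_of_eq_iff braid_eq.far)

lemma gen_braid:
  "1 \<le> i \<Longrightarrow> i + 1 < n \<Longrightarrow> gen i \<cdot> (gen (i + 1) \<cdot> gen i) = gen (i + 1) \<cdot> (gen i \<cdot> gen (i + 1))"
  unfolding gen_def using braid_eq.braid[of i n]
  by (simp add: mult_braid_of braid_of_eq_iff)

definition far_apart :: "braid_word \<Rightarrow> braid_word \<Rightarrow> bool" where
  "far_apart u v \<longleftrightarrow> (\<forall>x\<in>set u. \<forall>y\<in>set v. fst x + 2 \<le> fst y \<or> fst y + 2 \<le> fst x)"

lemma comm_letters:
  assumes "1 \<le> i" "i < n" "1 \<le> j" "j < n" "i + 2 \<le> j \<or> j + 2 \<le> i"
  shows "comm (braid_of n [(i, e)]) (braid_of n [(j, f)])"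
proof -
  have *: "comm (gen i) (gen j)" using gen_far assms comm_sym by metis
  have "braid_of n [(i, e)] \<in> {gen i, \<i> (gen i)}" "braid_of n [(j, f)] \<in> {gen j, \<i> (gen j)}"
    using assms by (cases e; simp add: braid_of_False gen_def)
      (cases f; use assms in \<open>simp add: braid_of_False gen_def\<close>)
  moreover have "comm (gen i) (\<i> (gen j))" using * assms by (simp add: comm_inv)
  moreover have "comm (\<i> (gen i)) (gen j)" using * assms by (simp add: comm_inv comm_sym)
  moreover then have "comm (\<i> (gen i)) (\<i> (gen j))" using assms by (simp add: comm_inv)
  ultimately show ?thesis using * by auto
qed

lemma comm_far_apart:
  assumes "u \<in> braid_words n" "v \<in> braid_words n" "far_apart u v"
  shows "comm (braid_of n u) (braid_of n v)"
  using assms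
proof (induction u)
  case Nil
  then show ?case by (simp add: braid_of_Nil comm_def)
next
  case (Cons x u)
  obtain i e where x: "x = (i, e)" by fastforce
  have "comm (braid_of n [(i, e)]) (braid_of n v)"
    using Cons.prems(2,3)
  proof (induction v)
    case Nil
    then show ?case using Cons.prems x by (simp add: braid_of_Nil comm_def)
  next
    case (Cons y v)
    obtain j f where y: "y = (j, f)" by fastforce
    have "comm (braid_of n [(i, e)]) (braid_of n [(j, f)])"
      using Cons.prems \<open>x # u \<in> _\<close> by (intro comm_letters) (auto simp: x y far_apart_def)
    moreover have "comm (braid_of n [(i, e)]) (braid_of n v)"
      using Cons by (auto simp: x y far_apart_def)
    ultimately show ?case
      using comm_mult[of "braid_of n [(i, e)]" "braid_of n [(j, f)]" "braid_of n v"]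
        braid_of_append[of "[(j, f)]" v] Cons.prems \<open>x # u \<in> _\<close>
      by (simp add: x y)
  qed
  moreover have "comm (braid_of n u) (braid_of n v)"
    using Cons by (auto simp: x far_apart_def)
  ultimately show ?case
    using comm_mult[of "braid_of n v" "braid_of n [(i, e)]" "braid_of n u"]
      braid_of_append[of "[(i, e)]" u] Cons.prems
    by (simp add: x comm_sym)
qed

lemma perm_mult: "x \<in> B \<Longrightarrow> y \<in> B \<Longrightarrow> perm (x \<cdot> y) = perm x \<circ> perm y"
  by (auto simp: carrier_braid_group mult_braid_of braid_of_invariants)

lemma expo_mult: "x \<in> B \<Longrightarrow> y \<in> B \<Longrightarrow> expo (x \<cdot> y) = expo x + expo y"
  by (auto simp: carrier_braid_group mult_braid_of braid_of_invariants)

lemma perm_one [simp]: "perm \<e> = id" and expo_one [simp]: "expo \<e> = 0"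
  by (simp_all add: one_braid_group braid_of_invariants)

lemma expo_inv: "x \<in> B \<Longrightarrow> expo (\<i> x) = - expo x"
  using expo_mult[of x "\<i> x"] by simp

lemma expo_conj: "g \<in> B \<Longrightarrow> x \<in> B \<Longrightarrow> expo (conj_by g x) = expo x"
  by (simp add: conj_by_def expo_mult expo_inv)

lemma expo_pow:
  assumes "x \<in> B"
  shows "expo (x [^]\<^bsub>braid_group n\<^esub> (k :: int)) = k * expo x"
proof -
  have nat: "expo (x [^]\<^bsub>braid_group n\<^esub> (m :: nat)) = int m * expo x" for m
    by (induction m) (simp_all add: assms expo_mult algebra_simps)
  show ?thesis
  proof (cases "k \<ge> 0")
    case True
    then obtain m where "k = int m" by (metis nonneg_int_cases)
    then show ?thesis using nat[of m] by (simp add: int_pow_int)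
  next
    case False
    then obtain m where "k = - int m" by (metis linear nonpos_int_cases)
    then show ?thesis
      using nat[of m] assms by (simp add: int_pow_neg_int expo_inv)
  qed
qed

section \<open>Band generators\<close>

lemma band_words:
  "1 \<le> s \<Longrightarrow> t \<le> n \<Longrightarrow> map (\<lambda>i. (i, True)) (rev [s..<t]) \<in> braid_words n"
  "1 \<le> s \<Longrightarrow> t \<le> n \<Longrightarrow> map (\<lambda>i. (i, False)) [s + 1..<t] \<in> braid_words n"
  by (auto simp: braid_words_def)

lemma band_closed [simp]: "1 \<le> s \<Longrightarrow> t \<le> n \<Longrightarrow> band n t s \<in> B"
  unfolding band_def using band_words by simp

lemma band_base: "band n (Suc s) s = gen s"
  by (simp add: band_def gen_def)

lemma band_Suc:
  assumes "1 \<le> s" "s < t" "t < n"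
  shows "band n (Suc t) s = conj_by (gen t) (band n t s)"
proof -
  let ?U = "map (\<lambda>i. (i, True)) (rev [s..<t]) @ map (\<lambda>i. (i, False)) [s + 1..<t]"
  have "map (\<lambda>i. (i, True)) (rev [s..<Suc t]) @ map (\<lambda>i. (i, False)) [s + 1..<Suc t] =
    [(t, True)] @ ?U @ [(t, False)]"
    using assms by simp
  moreover have "?U \<in> braid_words n" using assms band_words[of s t] by simp
  moreover have "braid_of n ?U = band n t s" by (simp add: band_def)
  ultimately have "band n (Suc t) s = gen t \<cdot> (band n t s \<cdot> \<i> (gen t))"
    using assms braid_of_append[of "[(t, True)]" "?U @ [(t, False)]"]
      braid_of_append[of ?U "[(t, False)]"]
    by (simp add: band_def[of n "Suc t"] braid_of_False gen_def[symmetric])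
  then show ?thesis using assms by (simp add: conj_by_def m_assoc)
qed

lemma perm_band_expo_band:
  assumes "1 \<le> s" "s < t" "t \<le> n"
  shows "perm (band n t s) = transpose t s \<and> expo (band n t s) = 1"
  using assms(2)[THEN Suc_leI] assms(3)
proof (induction t rule: dec_induct)
  case base
  then show ?case
    using assms by (simp add: band_base gen_def braid_of_invariants transpose_commute)
next
  case (step t)
  have "perm (\<i> (gen t)) = transpose t (Suc t)"
    using step assms by (simp add: braid_of_False[symmetric] braid_of_invariants)
  then show ?case
    using step assms
    by (auto simp: band_Suc conj_by_def perm_mult expo_mult expo_inv gen_def braid_of_invariants
        fun_eq_iff transpose_def)
qed

lemmas perm_band = perm_band_expo_band[THEN conjunct1]
lemmas expo_band = perm_band_expo_band[THEN conjunct2]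

lemma band_disjoint:
  assumes "1 \<le> q" "q < r" "r < s" "s < t" "t \<le> n"
  shows "comm (band n t s) (band n r q)"
  unfolding band_def
  by (rule comm_far_apart) (use assms in \<open>auto simp: braid_words_def far_apart_def\<close>)

lemma gen_band_disjoint:
  assumes "1 \<le> s" "s < t" "t < i" "i < n"
  shows "comm (gen i) (band n t s)"
  unfolding band_def gen_def
  by (rule comm_far_apart) (use assms in \<open>auto simp: braid_words_def far_apart_def\<close>)

text \<open>
  The essential case is \<open>t = i + 2\<close>, where \<open>(t s)\<close> is \<open>(i s)\<close>
  conjugated by \<open>\<sigma>\<^sub>i\<^sub>+\<^sub>1 \<sigma>\<^sub>i\<close>. By the braid
  relation this conjugation also carries \<open>\<sigma>\<^sub>i\<^sub>+\<^sub>1\<close>, which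
  commutes with \<open>(i s)\<close>, to \<open>\<sigma>\<^sub>i\<close>.
\<close>

lemma gen_band_nested:
  assumes "1 \<le> s" "s < i" "i + 1 < t" "t \<le> n"
  shows "comm (gen i) (band n t s)"
proof -
  have "Suc (Suc i) \<le> t" using assms by simp
  then show ?thesis using assms(4)
  proof (induction t rule: dec_induct)
    case base
    let ?a = "gen i" and ?b = "gen (Suc i)" and ?x = "band n i s"
    have B: "?a \<in> B" "?b \<in> B" "?x \<in> B" using assms base by auto
    have eq: "band n (Suc (Suc i)) s = conj_by (?b \<cdot> ?a) ?x"
      using assms base B by (simp add: band_Suc conj_conj)
    have ab: "?a \<cdot> (?b \<cdot> ?a) = ?b \<cdot> (?a \<cdot> ?b)" using gen_braid[of i] assms base by simp
    have "comm ?b ?x" using assms base by (intro gen_band_disjoint) auto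
    then have x: "conj_by ?b ?x = ?x" using B by (simp add: conj_comm)
    have "conj_by ?a (conj_by (?b \<cdot> ?a) ?x) = conj_by (?b \<cdot> ?a) (conj_by ?b ?x)"
      using B ab by (simp add: conj_conj m_assoc)
    then have "conj_by ?a (band n (Suc (Suc i)) s) = band n (Suc (Suc i)) s"
      by (simp only: eq x)
    moreover have "band n (Suc (Suc i)) s \<in> B" using assms base by simp
    ultimately show ?case using B(1) by (simp add: conj_eq_iff comm_def)
  next
    case (step t)
    have "comm (gen i) (gen t)" using step assms by (intro gen_far) auto
    moreover have "comm (gen i) (band n t s)" using step by simp
    ultimately show ?case
      using step assms by (simp add: band_Suc conj_by_def comm_mult comm_inv)
  qed
qed

lemma band_nested:
  assumes "1 \<le> s" "s < q" "q < r" "r < t" "t \<le> n"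
  shows "comm (band n t s) (band n r q)"
  using assms(3)[THEN Suc_leI] assms(4)
proof (induction r rule: dec_induct)
  case base
  then show ?case using assms gen_band_nested by (simp add: band_base comm_sym)
next
  case (step r)
  have "comm (band n t s) (gen r)" using step assms gen_band_nested by (simp add: comm_sym)
  then show ?case
    using step assms by (simp add: band_Suc conj_by_def comm_mult comm_inv)
qed

definition valid_chord :: "nat \<times> nat \<Rightarrow> bool" where
  "valid_chord = (\<lambda>(t, s). 1 \<le> s \<and> s < t \<and> t \<le> n)"

lemma noncrossing_bands_comm:
  assumes "valid_chord (t, s)" "valid_chord (u, v)" "noncrossing (t, s) (u, v)"
  shows "comm (band n t s) (band n u v)"
proof -
  have v: "1 \<le> s" "s < t" "t \<le> n" "1 \<le> v" "v < u" "u \<le> n"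
    using assms(1,2) by (auto simp: valid_chord_def)
  from assms(3) v(2,5) show ?thesis
  proof (cases rule: noncrossing_cases)
    case 1
    then show ?thesis using v by (intro comm_sym[OF band_disjoint]) auto
  next
    case 2
    then show ?thesis using v by (intro band_disjoint) auto
  next
    case 3
    then show ?thesis using v by (intro comm_sym[OF band_nested]) auto
  next
    case 4
    then show ?thesis using v by (intro band_nested) auto
  qed
qed

text \<open>
  The braid relation between \<open>\<sigma>\<^sub>s\<close> and \<open>(s r)\<close>: conjugation
  by \<open>\<sigma>\<^sub>s \<sigma>\<^sub>s\<^sub>+\<^sub>1\<close> carries the pair
  \<open>\<sigma>\<^sub>s, (s r)\<close> to \<open>\<sigma>\<^sub>s\<^sub>+\<^sub>1, (s+1
  r)\<close>, which reduces it to the Artin relation.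
\<close>

lemma gen_band_braid:
  assumes "1 \<le> r" "r < s" "s < n"
  shows "gen s \<cdot> band n s r = band n s r \<cdot> conj_by (gen s) (band n s r)"
proof -
  have "gen s \<cdot> (band n s r \<cdot> gen s) = band n s r \<cdot> (gen s \<cdot> band n s r)"
    using assms(2)[THEN Suc_leI] assms(3)
  proof (induction s rule: dec_induct)
    case base
    then show ?case using gen_braid[of r] assms by (simp add: band_base)
  next
    case (step s)
    let ?g = "gen s \<cdot> gen (Suc s)"
    have B: "gen s \<in> B" "gen (Suc s) \<in> B" "band n s r \<in> B" using step assms by auto
    have 1: "conj_by ?g (gen s) = gen (Suc s)"
      using gen_braid[of s] step assms B by (simp add: conj_eq_iff m_assoc)
    have "comm (gen (Suc s)) (band n s r)" using step assms by (intro gen_band_disjoint) auto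
    then have 2: "conj_by ?g (band n s r) = band n (Suc s) r"
      using step assms B by (simp add: band_Suc conj_conj[symmetric] conj_comm)
    have "conj_by ?g (gen s \<cdot> (band n s r \<cdot> gen s)) = conj_by ?g (band n s r \<cdot> (gen s \<cdot> band n s r))"
      using step by simp
    then show ?case using B by (simp add: conj_mult 1 2)
  qed
  then have *: "gen s \<cdot> (band n s r \<cdot> gen s) \<cdot> \<i> (gen s) =
    band n s r \<cdot> (gen s \<cdot> band n s r) \<cdot> \<i> (gen s)" by (rule arg_cong)
  have B: "gen s \<in> B" "band n s r \<in> B" using assms by auto
  have "gen s \<cdot> band n s r = gen s \<cdot> (band n s r \<cdot> gen s) \<cdot> \<i> (gen s)"
    using B by (simp add: m_assoc)
  also note *
  also have "band n s r \<cdot> (gen s \<cdot> band n s r) \<cdot> \<i> (gen s) = band n s r \<cdot> conj_by (gen s) (band n s r)"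
    using B by (simp add: conj_by_def m_assoc)
  finally show ?thesis .
qed

text \<open>
  The Birman--Ko--Lee relations. Conjugation by \<open>\<sigma>\<^sub>t\<close> moves the vertex
  \<open>t\<close> to \<open>t + 1\<close> and fixes \<open>(s r)\<close>, so the general case
  follows from \<open>t = s + 1\<close>.
\<close>

lemma band_triangle:
  assumes "1 \<le> r" "r < s" "s < t" "t \<le> n"
  shows "band n t s \<cdot> band n s r = band n t r \<cdot> band n t s"
    and "band n t s \<cdot> band n s r = band n s r \<cdot> band n t r"
proof -
  have "band n t s \<cdot> band n s r = band n t r \<cdot> band n t s \<and>
    band n t s \<cdot> band n s r = band n s r \<cdot> band n t r"
    using assms(3)[THEN Suc_leI] assms(4)
  proof (induction t rule: dec_induct)
    case base
    have B: "gen s \<in> B" "band n s r \<in> B" using base assms by auto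
    have "band n (Suc s) r = conj_by (gen s) (band n s r)" using base assms by (simp add: band_Suc)
    moreover have "conj_by (gen s) (band n s r) \<cdot> gen s = gen s \<cdot> band n s r"
      using B by (simp add: conj_by_def m_assoc)
    moreover have "gen s \<cdot> band n s r = band n s r \<cdot> conj_by (gen s) (band n s r)"
      using base assms by (intro gen_band_braid) auto
    ultimately show ?case by (simp add: band_base)
  next
    case (step t)
    have B: "gen t \<in> B" "band n s r \<in> B" "band n t s \<in> B" "band n t r \<in> B"
      using step assms by auto
    have "comm (gen t) (band n s r)" using step assms by (intro gen_band_disjoint) auto
    then have s: "band n s r = conj_by (gen t) (band n s r)" using B by (simp add: conj_comm)
    have "band n (Suc t) s = conj_by (gen t) (band n t s)" "band n (Suc t) r = conj_by (gen t) (band n t r)"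
      using step assms by (simp_all add: band_Suc)
    then show ?case
      using step B conj_mult s by (metis Suc_leD)
  qed
  then show "band n t s \<cdot> band n s r = band n t r \<cdot> band n t s"
    "band n t s \<cdot> band n s r = band n s r \<cdot> band n t r" by auto
qed

end

section \<open>Descending lists and the chords splitting them\<close>

lemma descending_distinct: "sorted_wrt (>) c \<Longrightarrow> distinct (c :: nat list)"
  by (induction c) auto

lemma split_at_two:
  assumes "sorted_wrt (>) c" "t \<in> set c" "s \<in> set c" "s < (t::nat)"
  obtains A C E where "c = A @ t # C @ s # E"
proof -
  obtain A R where c: "c = A @ t # R" using assms(2) split_list by fastforce
  then have "s \<in> set R" using assms by (auto simp: sorted_wrt_append)
  then obtain C E where "R = C @ s # E" using split_list by fastforce
  then show ?thesis using that c by simp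
qed

lemma split_sides:
  assumes "sorted_wrt (>) (A @ t # C @ s # E)"
  shows "x \<in> set (t # C) \<Longrightarrow> s < x \<and> x \<le> (t::nat)" "x \<in> set (A @ s # E) \<Longrightarrow> t < x \<or> x \<le> s"
proof -
  have "\<forall>a\<in>set A. t < a" "\<forall>c\<in>set C. c < t" "s < t" "\<forall>c\<in>set C. s < c" "\<forall>e\<in>set E. e < s"
    using assms by (auto simp: sorted_wrt_append)
  then show "x \<in> set (t # C) \<Longrightarrow> s < x \<and> x \<le> t" "x \<in> set (A @ s # E) \<Longrightarrow> t < x \<or> x \<le> s"
    by auto
qed

text \<open>
  Removing the chord \<open>(t, s)\<close> on the left splits a descending cycle into its entries in
  \<open>{s<..t}\<close> and the others; a chord satisfying this condition is not cut by the
  splitting.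
\<close>

definition same_side :: "nat \<times> nat \<Rightarrow> nat \<times> nat \<Rightarrow> bool" where
  "same_side = (\<lambda>(t, s) (u, v). (s < u \<and> u \<le> t) = (s < v \<and> v \<le> t))"

lemma same_side_chords: "sorted_wrt (>) c \<Longrightarrow> sorted_wrt same_side (chords c)"
proof (induction c)
  case (Cons a c)
  show ?case
  proof (cases c)
    case (Cons b d)
    have "same_side (a, b) q" if "q \<in> set (chords c)" for q
    proof -
      obtain u v where q: "q = (u, v)" by fastforce
      have "u \<in> set c" "v \<in> set c" using that chords_subset q by blast+
      then have "u \<le> b" "v \<le> b" using Cons.prems by (auto simp: Cons)
      then show ?thesis by (simp add: q same_side_def)
    qed
    then show ?thesis using Cons.IH Cons.prems by (simp add: Cons)
  qed simp
qed simp

lemma noncrossing_same_side: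
  assumes "noncrossing (t, s) (u, v)" "s < t" "v < u"
  shows "same_side (t, s) (u, v)"
  by (rule noncrossing_cases[OF assms]) (use assms in \<open>auto simp: same_side_def\<close>)

lemma same_side_all_chords:
  assumes "\<forall>c\<in>set cs. sorted_wrt (>) c" "sorted_wrt parallel cs"
  shows "sorted_wrt same_side (concat (map chords cs))"
  using assms
proof (induction cs)
  case (Cons c cs)
  have "same_side p q" if "p \<in> set (chords c)" "d \<in> set cs" "q \<in> set (chords d)" for p d q
  proof -
    obtain t s u v where pq: "p = (t, s)" "q = (u, v)" by fastforce
    have "noncrossing p q" using Cons.prems that by (auto simp: parallel_iff_chords)
    moreover have "s < t" "v < u" using chords_descending Cons.prems that pq by auto
    ultimately show ?thesis using noncrossing_same_side pq by simp
  qed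
  then show ?case using Cons same_side_chords[of c] by (auto simp: sorted_wrt_append)
qed simp

context braid
begin

section \<open>Products of band generators and descending cycles\<close>

lemma braid_prod_simps [simp]:
  "braid_prod n [] = \<e>" "braid_prod n (x # xs) = x \<cdot> braid_prod n xs"
  by (simp_all add: braid_prod_def)

lemma braid_prod_closed [simp]: "set xs \<subseteq> B \<Longrightarrow> braid_prod n xs \<in> B"
  by (induction xs) auto

definition bands :: "(nat \<times> nat) list \<Rightarrow> braid" where
  "bands ps = braid_prod n (map (\<lambda>(t, s). band n t s) ps)"

abbreviation valid_chords :: "(nat \<times> nat) list \<Rightarrow> bool" where
  "valid_chords ps \<equiv> \<forall>p\<in>set ps. valid_chord p"

lemma bands_simps [simp]: "bands [] = \<e>" "bands ((t, s) # ps) = band n t s \<cdot> bands ps"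
  by (simp_all add: bands_def)

lemma valid_band_closed [simp]: "valid_chord (t, s) \<Longrightarrow> band n t s \<in> B"
  by (auto simp: valid_chord_def)

lemma bands_closed [simp]: "valid_chords ps \<Longrightarrow> bands ps \<in> B"
  by (induction ps) auto

lemma bands_append:
  "valid_chords ps \<Longrightarrow> valid_chords qs \<Longrightarrow> bands (ps @ qs) = bands ps \<cdot> bands qs"
  by (induction ps) (auto simp: m_assoc)

lemma comm_bands:
  assumes "x \<in> B" "valid_chords ps" "\<forall>(t, s)\<in>set ps. comm x (band n t s)"
  shows "comm x (bands ps)"
  using assms(2,3) by (induction ps) (auto simp: assms(1) comm_one intro!: comm_mult)

lemma comm_bands_bands:
  assumes "valid_chords ps" "valid_chords qs" "\<forall>p\<in>set ps. \<forall>q\<in>set qs. noncrossing p q"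
  shows "comm (bands ps) (bands qs)"
proof (rule comm_bands)
  show "\<forall>(u, v)\<in>set qs. comm (bands ps) (band n u v)"
  proof clarify
    fix u v assume uv: "(u, v) \<in> set qs"
    have "comm (band n u v) (bands ps)"
      using assms uv by (intro comm_bands) (auto intro!: comm_sym[OF noncrossing_bands_comm])
    then show "comm (bands ps) (band n u v)" by (rule comm_sym)
  qed
qed (use assms in auto)

lemma expo_bands: "valid_chords ps \<Longrightarrow> expo (bands ps) = int (length ps)"
  by (induction ps) (auto simp: expo_mult expo_band valid_chord_def)

abbreviation cyc :: "nat list \<Rightarrow> braid" where "cyc c \<equiv> descending_cycle n c"

lemma cyc_bands: "cyc c = bands (chords c)"
  by (simp add: descending_cycle_def bands_def chords_def)

lemma descending_valid: "descending n c \<Longrightarrow> valid_chords (chords c)"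
  using chords_subset chords_descending
  unfolding descending_def valid_chord_def by (fastforce simp: subset_iff)

lemma cyc_closed [simp]: "descending n c \<Longrightarrow> cyc c \<in> B"
  by (simp add: cyc_bands descending_valid)

lemma cyc_append:
  assumes "descending n (A @ x # C)"
  shows "cyc (A @ x # C) = cyc (A @ [x]) \<cdot> cyc (x # C)"
proof -
  have "descending n (A @ [x])" "descending n (x # C)"
    using assms by (auto simp: descending_def sorted_wrt_append)
  then show ?thesis
    unfolding cyc_bands chords_append[of A x C] by (simp add: bands_append descending_valid)
qed

lemma cyc_Cons: "cyc (a # b # C) = band n a b \<cdot> cyc (b # C)"
  by (simp add: cyc_bands)

lemma cyc_single [simp]: "cyc [] = \<e>" "cyc [a] = \<e>"
  by (simp_all add: cyc_bands)

lemma cyc_snoc: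
  assumes "descending n (A @ [a, b])"
  shows "cyc (A @ [a, b]) = cyc (A @ [a]) \<cdot> band n a b"
  using cyc_append[of A a "[b]"] assms
  by (simp add: cyc_Cons) (auto simp: descending_def sorted_wrt_append)

lemma comm_cyc_band:
  assumes "descending n c" "valid_chord (t, s)" "(\<forall>x\<in>set c. t < x) \<or> (\<forall>x\<in>set c. x < s)"
  shows "comm (cyc c) (band n t s)"
proof -
  have "noncrossing p (t, s)" if p: "p \<in> set (chords c)" for p
  proof -
    obtain u v where uv: "p = (u, v)" by fastforce
    then have "u \<in> set c" "v \<in> set c" "v < u"
      using chords_subset[of u v c] chords_descending[of c u v] assms(1) p
      by (auto simp: descending_def)
    then show ?thesis
      using assms noncrossing_iff[of v u s t] by (auto simp: uv valid_chord_def)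
  qed
  then have "comm (bands (chords c)) (bands [(t, s)])"
    using assms descending_valid by (intro comm_bands_bands) auto
  then show ?thesis using assms by (simp add: cyc_bands)
qed

text \<open>
  The relation \<open>(t b) (b s) = (t s) (t b)\<close> moves the long chord to the front, one entry
  \<open>b\<close> of \<open>C\<close> at a time.
\<close>

lemma cyc_extract_left:
  assumes "descending n (t # C @ [s])"
  shows "cyc (t # C @ [s]) = band n t s \<cdot> cyc (t # C)"
  using assms
proof (induction C arbitrary: s rule: rev_induct)
  case Nil
  then show ?case by (simp add: cyc_Cons)
next
  case (snoc b C)
  have d: "descending n (t # C @ [b])" "descending n (t # C)"
    and v: "valid_chord (b, s)" "valid_chord (t, b)" "valid_chord (t, s)"
    and tri: "1 \<le> s" "s < b" "b < t" "t \<le> n"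
    using snoc.prems by (auto simp: descending_def sorted_wrt_append valid_chord_def)
  have IH: "cyc (t # C @ [b]) = band n t b \<cdot> cyc (t # C)" using snoc.IH d by blast
  have "comm (cyc (t # C)) (band n b s)"
    using snoc.prems by (intro comm_cyc_band d v) (auto simp: descending_def sorted_wrt_append)
  then have c: "cyc (t # C) \<cdot> band n b s = band n b s \<cdot> cyc (t # C)" by (simp add: comm_def)
  have "cyc (t # (C @ [b]) @ [s]) = cyc (t # C @ [b]) \<cdot> band n b s"
    using cyc_snoc[of "t # C" b s] snoc.prems by simp
  also have "\<dots> = (band n t b \<cdot> band n b s) \<cdot> cyc (t # C)"
    using d v by (simp add: IH m_assoc c)
  also have "\<dots> = band n t s \<cdot> cyc (t # C @ [b])"
    using d v unfolding IH band_triangle(1)[OF tri] by (simp add: m_assoc)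
  finally show ?case .
qed

lemma cyc_extract_right:
  assumes "descending n (t # C @ [s])"
  shows "cyc (t # C @ [s]) = cyc (C @ [s]) \<cdot> band n t s"
  using assms
proof (induction C arbitrary: t)
  case Nil
  then show ?case by (simp add: cyc_Cons) (auto simp: descending_def)
next
  case (Cons b C)
  have d: "descending n (b # C @ [s])" "descending n (C @ [s])"
    and v: "valid_chord (b, s)" "valid_chord (t, b)" "valid_chord (t, s)"
    and tri: "1 \<le> s" "s < b" "b < t" "t \<le> n"
    using Cons.prems by (auto simp: descending_def sorted_wrt_append valid_chord_def)
  have IH: "cyc (b # C @ [s]) = cyc (C @ [s]) \<cdot> band n b s" using Cons.IH d by blast
  have "comm (cyc (C @ [s])) (band n t b)"
    using Cons.prems by (intro comm_cyc_band d v) (auto simp: descending_def sorted_wrt_append)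
  then have c: "band n t b \<cdot> cyc (C @ [s]) = cyc (C @ [s]) \<cdot> band n t b" by (simp add: comm_def)
  have "cyc (t # (b # C) @ [s]) = band n t b \<cdot> cyc (C @ [s]) \<cdot> band n b s"
    using d v by (simp add: cyc_Cons IH m_assoc)
  also have "\<dots> = cyc (C @ [s]) \<cdot> (band n t b \<cdot> band n b s)"
    unfolding c using d v by (simp add: m_assoc)
  also have "\<dots> = cyc ((b # C) @ [s]) \<cdot> band n t s"
    unfolding band_triangle(2)[OF tri] using d v by (simp add: IH m_assoc)
  finally show ?case .
qed

lemma cyc_slide:
  assumes "descending n (A @ [t, s])"
  shows "cyc (A @ [t]) \<cdot> band n t s = band n t s \<cdot> cyc (A @ [s])"
proof (cases A rule: rev_cases)
  case Nil
  then show ?thesis using assms by (auto simp: descending_def)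
next
  case (snoc A' a)
  have d: "descending n (A' @ [a, t])" "descending n (A' @ [a, s])" "descending n (A' @ [a])"
    and v: "valid_chord (t, s)" "valid_chord (a, t)" "valid_chord (a, s)"
    and tri: "1 \<le> s" "s < t" "t < a" "a \<le> n"
    using assms by (auto simp: snoc descending_def sorted_wrt_append valid_chord_def)
  have "comm (cyc (A' @ [a])) (band n t s)"
    using assms by (intro comm_cyc_band d v) (auto simp: snoc descending_def sorted_wrt_append)
  then have c: "cyc (A' @ [a]) \<cdot> band n t s = band n t s \<cdot> cyc (A' @ [a])" by (simp add: comm_def)
  have "cyc (A @ [t]) \<cdot> band n t s = cyc (A' @ [a]) \<cdot> (band n a t \<cdot> band n t s)"
    using cyc_snoc[OF d(1)] d v by (simp add: snoc m_assoc)
  also have "\<dots> = (cyc (A' @ [a]) \<cdot> band n t s) \<cdot> band n a s"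
    unfolding band_triangle(2)[OF tri] using d v by (simp add: m_assoc)
  also have "\<dots> = band n t s \<cdot> cyc (A @ [s])"
    unfolding c using cyc_snoc[OF d(2)] d v by (simp add: snoc m_assoc)
  finally show ?thesis .
qed

lemma parallel_split:
  assumes "sorted_wrt (>) (A @ t # C @ s # E)"
  shows "parallel (t # C) (A @ s # E)"
proof -
  have "noncrossing (x, y) (u, v)"
    if "x \<in> set (t # C)" "y \<in> set (t # C)" "u \<in> set (A @ s # E)" "v \<in> set (A @ s # E)" for x y u v
  proof -
    have *: "(int x - int u) * (int y - int u) > 0"
      if "x \<in> set (t # C)" "y \<in> set (t # C)" "u \<in> set (A @ s # E)" for x y u
    proof -
      have "s < x" "x \<le> t" "s < y" "y \<le> t" "t < u \<or> u \<le> s"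
        using split_sides[OF assms] that by blast+
      then show ?thesis by (auto intro: mult_pos_pos mult_neg_neg)
    qed
    have "((int x - int u) * (int y - int u)) * ((int x - int v) * (int y - int v)) > 0"
      using *[OF that(1,2,3)] *[OF that(1,2,4)] by (rule mult_pos_pos)
    then show ?thesis by (simp add: noncrossing_def mult_ac)
  qed
  then show ?thesis
    unfolding parallel_iff_chords using chords_subset by (metis surj_pair)
qed

lemma comm_parallel_cyc:
  assumes "descending n c" "descending n d" "parallel c d"
  shows "comm (cyc c) (cyc d)"
  unfolding cyc_bands using assms descending_valid
  by (intro comm_bands_bands) (auto simp: parallel_iff_chords)

text \<open>
  The key to divisibility of canonical factors: a chord between two entries of a cycle can be split
  off on the left, and what remains is the product of two parallel descending cycles, one on either
  side of the chord.
\<close>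

lemma cyc_split:
  assumes "descending n (A @ t # C @ s # E)"
  shows "cyc (A @ t # C @ s # E) = band n t s \<cdot> (cyc (t # C) \<cdot> cyc (A @ s # E))"
proof -
  have d: "descending n (A @ [t])" "descending n (t # C @ s # E)" "descending n (t # C @ [s])"
     "descending n (s # E)" "descending n (t # C)" "descending n (A @ s # E)"
     "descending n (A @ [t, s])" "descending n (A @ [s])"
    and v: "valid_chord (t, s)"
    using assms by (auto simp: descending_def sorted_wrt_append valid_chord_def)
  have B: "cyc (A @ [t]) \<in> B" "band n t s \<in> B" "cyc (t # C) \<in> B" "cyc (s # E) \<in> B"
      "cyc (A @ [s]) \<in> B"
    using d v by simp_all
  have "parallel (t # C) (A @ [s])"
    using assms by (intro parallel_split[of A t C s "[]"]) (auto simp: descending_def sorted_wrt_append)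
  then have c: "cyc (A @ [s]) \<cdot> cyc (t # C) = cyc (t # C) \<cdot> cyc (A @ [s])"
    using comm_parallel_cyc[of "t # C" "A @ [s]"] d by (simp add: comm_def)
  have "cyc (A @ t # C @ s # E) = cyc (A @ [t]) \<cdot> (cyc (t # C @ [s]) \<cdot> cyc (s # E))"
    using cyc_append[OF assms] cyc_append[of "t # C" s E] d by simp
  also have "\<dots> = (cyc (A @ [t]) \<cdot> band n t s) \<cdot> (cyc (t # C) \<cdot> cyc (s # E))"
    using B by (simp add: cyc_extract_left[OF d(3)] m_assoc)
  also have "\<dots> = band n t s \<cdot> ((cyc (A @ [s]) \<cdot> cyc (t # C)) \<cdot> cyc (s # E))"
    using B by (simp add: cyc_slide[OF d(7)] m_assoc)
  also have "\<dots> = band n t s \<cdot> (cyc (t # C) \<cdot> cyc (A @ s # E))"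
    unfolding c using B by (simp add: cyc_append[OF d(6)] m_assoc)
  finally show ?thesis .
qed

section \<open>Canonical factors\<close>

definition parallel_cycles :: "nat list list \<Rightarrow> bool" where
  "parallel_cycles cs \<longleftrightarrow> (\<forall>c\<in>set cs. descending n c) \<and> sorted_wrt parallel cs"

abbreviation cycs :: "nat list list \<Rightarrow> braid" where "cycs cs \<equiv> braid_prod n (map cyc cs)"

abbreviation CF :: "braid set" where "CF \<equiv> canonical_factors n"

lemma CF_iff: "X \<in> CF \<longleftrightarrow> (\<exists>cs. parallel_cycles cs \<and> X = cycs cs)"
  by (auto simp: canonical_factors_def parallel_cycles_def)

lemma cycs_closed [simp]: "parallel_cycles cs \<Longrightarrow> cycs cs \<in> B"
  by (auto simp: parallel_cycles_def intro!: braid_prod_closed)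

lemma CF_closed [simp]: "X \<in> CF \<Longrightarrow> X \<in> B"
  by (auto simp: CF_iff)

lemma cycs_bands:
  assumes "parallel_cycles cs"
  shows "cycs cs = bands (concat (map chords cs))" "valid_chords (concat (map chords cs))"
proof -
  have "\<forall>c\<in>set cs. descending n c" using assms by (simp add: parallel_cycles_def)
  then have "cycs cs = bands (concat (map chords cs)) \<and> valid_chords (concat (map chords cs))"
  proof (induction cs)
    case (Cons c cs)
    then show ?case
      using bands_append[of "chords c" "concat (map chords cs)"] descending_valid[of c]
      by (auto simp: cyc_bands)
  qed simp
  then show "cycs cs = bands (concat (map chords cs))" "valid_chords (concat (map chords cs))"
    by auto
qed

lemma cycs_to_front:
  assumes "parallel_cycles (L @ c # R)"
  shows "cycs (L @ c # R) = cyc c \<cdot> cycs (L @ R)"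
  using assms
proof (induction L)
  case (Cons d L)
  have pc: "parallel_cycles (L @ c # R)" "descending n c" "descending n d" "parallel d c"
    and pc2: "parallel_cycles (L @ R)"
    using Cons.prems by (auto simp: parallel_cycles_def sorted_wrt_append)
  have B: "cyc c \<in> B" "cyc d \<in> B" "cycs (L @ R) \<in> B"
    using pc cycs_closed[OF pc2] by simp_all
  have "cycs ((d # L) @ c # R) = cyc d \<cdot> (cyc c \<cdot> cycs (L @ R))"
    using Cons.IH pc by simp
  also have "\<dots> = cyc c \<cdot> (cyc d \<cdot> cycs (L @ R))"
    using comm_parallel_cyc[OF pc(3,2,4)] B by (simp add: comm_cancel)
  finally show ?case by simp
qed simp

text \<open>
  Splitting off a chord keeps a family of parallel cycles parallel. The last conclusion records
  which further chords can still be split off.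
\<close>

lemma extract_chord:
  assumes cs: "parallel_cycles cs" and c: "c \<in> set cs" "t \<in> set c" "s \<in> set c" "s < t"
  obtains cs' where "parallel_cycles cs'" "cycs cs = band n t s \<cdot> cycs cs'"
    "\<And>d u v. d \<in> set cs \<Longrightarrow> u \<in> set d \<Longrightarrow> v \<in> set d \<Longrightarrow> same_side (t, s) (u, v) \<Longrightarrow>
      \<exists>d'\<in>set cs'. u \<in> set d' \<and> v \<in> set d'"
proof -
  obtain L R where LR: "cs = L @ c # R" using c split_list by fastforce
  have desc: "descending n c" using cs c by (simp add: parallel_cycles_def)
  then have "sorted_wrt (>) c" by (simp add: descending_def)
  then obtain A C E where ce: "c = A @ t # C @ s # E" using c split_at_two by metis
  let ?c1 = "t # C" and ?c2 = "A @ s # E"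
  let ?cs' = "?c1 # ?c2 # L @ R"
  have d12: "descending n ?c1" "descending n ?c2"
    using desc by (auto simp: ce descending_def sorted_wrt_append)
  have "\<forall>d\<in>set L. parallel d c" "\<forall>d\<in>set R. parallel c d"
    and rest: "\<forall>d\<in>set (L @ R). descending n d" "sorted_wrt parallel (L @ R)"
    using cs by (auto simp: LR parallel_cycles_def sorted_wrt_append)
  then have par: "\<forall>d\<in>set (L @ R). parallel c d" using parallel_commute by fastforce
  have dist: "distinct ?c1" "distinct ?c2"
    using d12 descending_distinct unfolding descending_def by blast+
  have sub: "\<forall>d\<in>set (L @ R). parallel ?c1 d \<and> parallel ?c2 d"
  proof -
    have "set ?c1 \<subseteq> set c" "set ?c2 \<subseteq> set c" by (auto simp: ce)
    then show ?thesis using par parallel_sublist dist by blast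
  qed
  have "parallel ?c1 ?c2" using desc by (intro parallel_split) (auto simp: ce descending_def)
  then have pc: "parallel_cycles ?cs'"
    unfolding parallel_cycles_def using d12 rest sub by simp
  have pcLR: "parallel_cycles (L @ R)" using rest by (simp add: parallel_cycles_def)
  have B: "cyc ?c1 \<in> B" "cyc ?c2 \<in> B" "cycs (L @ R) \<in> B" "band n t s \<in> B"
    using d12 cycs_closed[OF pcLR] desc c
    by (simp_all add: descending_def subset_iff)
  have "cycs cs = cyc c \<cdot> cycs (L @ R)" using cycs_to_front cs by (simp add: LR)
  also have "\<dots> = band n t s \<cdot> cycs ?cs'"
    using cyc_split[of A t C s E] desc B by (simp add: ce m_assoc)
  finally have eq: "cycs cs = band n t s \<cdot> cycs ?cs'" .
  show ?thesis
  proof (rule that[OF pc eq])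
    fix d u v
    assume d: "d \<in> set cs" "u \<in> set d" "v \<in> set d" and ss: "same_side (t, s) (u, v)"
    show "\<exists>d'\<in>set ?cs'. u \<in> set d' \<and> v \<in> set d'"
    proof (cases "d = c")
      case True
      have side: "x \<in> set ?c1 \<longleftrightarrow> s < x \<and> x \<le> t" if "x \<in> set c" for x
        using desc that split_sides[of A t C s E x] unfolding ce descending_def by force
      have "x \<in> set ?c1 \<or> x \<in> set ?c2" if "x \<in> set c" for x
        using that by (auto simp: ce)
      moreover have "u \<in> set ?c1 \<longleftrightarrow> v \<in> set ?c1"
        using side d True ss by (simp add: same_side_def)
      ultimately show ?thesis using d True by auto
    next
      case False
      then show ?thesis using d by (auto simp: LR)
    qed
  qed
qed

lemma extract_chords:
  assumes "parallel_cycles cs" "sorted_wrt same_side ps" "valid_chords ps"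
    "\<forall>(t, s)\<in>set ps. \<exists>c\<in>set cs. t \<in> set c \<and> s \<in> set c"
  shows "\<exists>cs'. parallel_cycles cs' \<and> cycs cs = bands ps \<cdot> cycs cs'"
  using assms
proof (induction ps arbitrary: cs)
  case Nil
  then show ?case by auto
next
  case (Cons p ps)
  obtain t s where p: "p = (t, s)" by fastforce
  obtain c where "c \<in> set cs" "t \<in> set c" "s \<in> set c" "s < t"
    using Cons.prems by (auto simp: p valid_chord_def)
  then obtain cs1 where cs1: "parallel_cycles cs1" "cycs cs = band n t s \<cdot> cycs cs1"
    "\<And>d u v. d \<in> set cs \<Longrightarrow> u \<in> set d \<Longrightarrow> v \<in> set d \<Longrightarrow> same_side (t, s) (u, v) \<Longrightarrow>
      \<exists>d'\<in>set cs1. u \<in> set d' \<and> v \<in> set d'"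
    using extract_chord[OF Cons.prems(1)] by blast
  have "\<exists>c\<in>set cs1. u \<in> set c \<and> v \<in> set c" if "(u, v) \<in> set ps" for u v
    using cs1(3) Cons.prems(2,4) that by (fastforce simp: p)
  then obtain cs' where cs': "parallel_cycles cs'" "cycs cs1 = bands ps \<cdot> cycs cs'"
    using Cons.IH[OF cs1(1)] Cons.prems by auto
  have "cycs cs = bands (p # ps) \<cdot> cycs cs'"
    using cs1(2) cs' Cons.prems(3) by (simp add: p m_assoc)
  then show ?case using cs'(1) by blast
qed

abbreviation \<delta> :: braid where "\<delta> \<equiv> delta n"

lemma delta_descending: "descending n (rev [1..<n + 1])"
  by (auto simp: descending_def sorted_wrt_rev simp del: upt_Suc)

lemma delta_closed [simp]: "\<delta> \<in> B"
  unfolding delta_def using delta_descending by (rule cyc_closed)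

lemma length_chords: "length (chords c) = length c - 1"
  by (simp add: chords_def)

lemma expo_delta: "expo \<delta> = int n - 1"
proof -
  have "expo \<delta> = int (length (chords (rev [1..<n + 1])))"
    unfolding delta_def cyc_bands using delta_descending descending_valid
    by (intro expo_bands) blast
  then show ?thesis using n_ge_2 by (simp add: length_chords)
qed

text \<open>
  The complement of a divisor of the fundamental word (the Kreweras complement, on the level of
  noncrossing partitions).
\<close>

definition star :: "braid \<Rightarrow> braid" where "star X = \<i> X \<cdot> \<delta>"

lemma star_closed [simp]: "X \<in> B \<Longrightarrow> star X \<in> B"
  by (simp add: star_def)

lemma mult_star [simp]: "X \<in> B \<Longrightarrow> X \<cdot> star X = \<delta>"
  by (simp add: star_def)

text \<open>
  A canonical factor is a product of chords that can be split off one after the other from the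
  single cycle \<open>\<delta>\<close>; the quotient is again a product of parallel cycles.
\<close>

lemma star_canonical:
  assumes "X \<in> CF"
  shows "star X \<in> CF"
proof -
  obtain cs where cs: "parallel_cycles cs" "X = cycs cs" using assms by (auto simp: CF_iff)
  let ?ps = "concat (map chords cs)" and ?d = "rev [1..<n + 1]"
  have valid: "valid_chords ?ps" and X: "X = bands ?ps" using cycs_bands[OF cs(1)] cs(2) by auto
  have ss: "sorted_wrt same_side ?ps"
    using cs(1) by (intro same_side_all_chords) (auto simp: parallel_cycles_def descending_def)
  have pd: "parallel_cycles [?d]" using delta_descending by (simp add: parallel_cycles_def)
  have "\<exists>c\<in>set [?d]. t \<in> set c \<and> s \<in> set c" if "(t, s) \<in> set ?ps" for t s
    using valid that by (fastforce simp: valid_chord_def)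
  then obtain cs' where cs': "parallel_cycles cs'" "cycs [?d] = bands ?ps \<cdot> cycs cs'"
    using extract_chords[OF pd ss valid] by blast
  have "\<delta> = X \<cdot> cycs cs'"
  proof -
    have "cycs [?d] = \<delta>" using delta_closed unfolding delta_def by simp
    then show ?thesis using cs'(2) X by simp
  qed
  then have "star X = cycs cs'" using cs' CF_closed[OF assms] by (simp add: star_def)
  then show ?thesis using cs' by (auto simp: CF_iff)
qed

lemma expo_star: "X \<in> B \<Longrightarrow> expo (star X) = int n - 1 - expo X"
  by (simp add: star_def expo_mult expo_inv expo_delta)

lemma CF_bands:
  assumes "X \<in> CF"
  obtains ps where "valid_chords ps" "X = bands ps" "expo X = int (length ps)"
  using assms cycs_bands expo_bands unfolding CF_iff by metis

text \<open>
  The upper bound on the exponent sum and its equality case are the lower bound and its equality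
  case for the complement.
\<close>

lemma CF_expo:
  assumes "X \<in> CF"
  shows "0 \<le> expo X" "expo X \<le> int n - 1"
    "expo X = 0 \<Longrightarrow> X = \<e>" "expo X = int n - 1 \<Longrightarrow> X = \<delta>"
    "expo X = 1 \<Longrightarrow> \<exists>t s. valid_chord (t, s) \<and> X = band n t s"
proof -
  have pos: "0 \<le> expo Y" and zero: "expo Y = 0 \<Longrightarrow> Y = \<e>" if Y: "Y \<in> CF" for Y
  proof -
    obtain ps where "Y = bands ps" "expo Y = int (length ps)" using CF_bands[OF Y] by blast
    then show "0 \<le> expo Y" "expo Y = 0 \<Longrightarrow> Y = \<e>" by auto
  qed
  have star: "star X \<in> CF" and B: "X \<in> B" using assms star_canonical by auto
  show "0 \<le> expo X" "expo X = 0 \<Longrightarrow> X = \<e>" using pos zero assms by auto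
  show "expo X \<le> int n - 1" using pos[OF star] by (simp add: expo_star B)
  show "X = \<delta>" if "expo X = int n - 1"
  proof -
    have "star X = \<e>" using zero[OF star] that by (simp add: expo_star B)
    then show ?thesis using mult_star[OF B] B by simp
  qed
  show "\<exists>t s. valid_chord (t, s) \<and> X = band n t s" if "expo X = 1"
  proof -
    obtain ps where ps: "valid_chords ps" "X = bands ps" "expo X = int (length ps)"
      using CF_bands[OF assms] by blast
    then obtain p where "ps = [p]" using \<open>expo X = 1\<close> by (auto simp: length_Suc_conv)
    then show ?thesis using ps by (cases p) auto
  qed
qed

lemma noncrossing_bands_canonical:
  assumes "valid_chords ps" "sorted_wrt noncrossing ps"
  shows "bands ps \<in> CF"
proof -
  let ?cs = "map (\<lambda>(t, s). [t, s]) ps"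
  have "parallel_cycles ?cs"
    using assms unfolding parallel_cycles_def
    by (auto simp: sorted_wrt_map descending_def valid_chord_def parallel_iff_chords
        elim!: sorted_wrt_mono_rel[rotated])
  moreover have "bands ps = cycs ?cs"
    using assms(1) by (induction ps) (auto simp: cyc_Cons)
  ultimately show ?thesis by (auto simp: CF_iff)
qed

lemma band_canonical: "valid_chord (t, s) \<Longrightarrow> band n t s \<in> CF"
  using noncrossing_bands_canonical[of "[(t, s)]"] by simp

end

section \<open>Auxiliary facts on lists and finite set systems\<close>

lemma noncrossing_pairs:
  assumes "sorted_wrt noncrossing ps" "p \<in> set ps" "q \<in> set ps" "p \<noteq> q"
  shows "noncrossing p q"
  using assms
proof (induction ps)
  case (Cons a ps)
  then show ?case using noncrossing_commute[of a q] noncrossing_commute[of a p] by auto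
qed simp

text \<open>
  Symmetric difference with a fixed set that separates \<open>s\<close> from \<open>t\<close> maps
  the separating sets injectively to the others.
\<close>

lemma card_separated_sets:
  fixes F :: "'a set set"
  assumes "finite F" "\<And>I J. I \<in> F \<Longrightarrow> J \<in> F \<Longrightarrow> sym_diff I J \<in> F"
  shows "card F \<le> 2 * card {I \<in> F. t \<in> I \<longleftrightarrow> s \<in> I}"
proof -
  let ?G = "{I \<in> F. t \<in> I \<longleftrightarrow> s \<in> I}" and ?H = "{I \<in> F. \<not> (t \<in> I \<longleftrightarrow> s \<in> I)}"
  have fin: "finite ?G" "finite ?H" using assms(1) by auto
  have "card ?H \<le> card ?G"
  proof (cases "?H = {}")
    case False
    then obtain J where J: "J \<in> ?H" by blast
    have "inj_on (sym_diff J) ?H" by (rule inj_onI) blast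
    moreover have "sym_diff J ` ?H \<subseteq> ?G"
    proof
      fix K assume "K \<in> sym_diff J ` ?H"
      then obtain I where I: "I \<in> ?H" "K = sym_diff J I" by blast
      then have "K \<in> F" using assms(2)[of J I] J by simp
      then show "K \<in> ?G" using I J by auto
    qed
    ultimately show ?thesis using fin(1) by (rule card_inj_on_le)
  qed (simp only: card.empty zero_le)
  moreover have "card F = card ?G + card ?H"
  proof -
    have "F = ?G \<union> ?H" "?G \<inter> ?H = {}" by blast+
    then show ?thesis using card_Un_disjoint[OF fin] by simp
  qed
  ultimately show ?thesis by simp
qed

lemma sum_list_between:
  fixes xs :: "int list"
  assumes "\<forall>x\<in>set xs. a \<le> x \<and> x \<le> b"
  shows "int (length xs) * a \<le> sum_list xs \<and> sum_list xs \<le> int (length xs) * b"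
  using assms
proof (induction xs)
  case (Cons x xs)
  then have "a \<le> x" "x \<le> b" "int (length xs) * a \<le> sum_list xs" "sum_list xs \<le> int (length xs) * b"
    by auto
  then show ?case by (simp add: distrib_right)
qed simp

context braid
begin

section \<open>Conjugation by the fundamental word\<close>

text \<open>
  Rotation of the polygon by one step; twice taking the complement has the same effect, hence
  rotation preserves canonical factors.
\<close>

definition tau :: "braid \<Rightarrow> braid" where "tau = conj_by (\<i> \<delta>)"

lemma tau_eq: "X \<in> B \<Longrightarrow> Y \<in> B \<Longrightarrow> X \<cdot> \<delta> = \<delta> \<cdot> Y \<Longrightarrow> tau X = Y"
  unfolding tau_def conj_by_def by (simp add: m_assoc)

lemma tau_closed [simp]: "X \<in> B \<Longrightarrow> tau X \<in> B"
  by (simp add: tau_def)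

lemma tau_mult: "X \<in> B \<Longrightarrow> Y \<in> B \<Longrightarrow> tau (X \<cdot> Y) = tau X \<cdot> tau Y"
  by (simp add: tau_def conj_mult)

lemma tau_inv: "X \<in> B \<Longrightarrow> tau (\<i> X) = \<i> (tau X)"
  by (simp add: tau_def conj_inv)

lemma tau_delta [simp]: "tau \<delta> = \<delta>"
  by (rule tau_eq) auto

lemma star_star: "X \<in> B \<Longrightarrow> star (star X) = tau X"
  by (simp add: star_def tau_def conj_by_def inv_mult_group m_assoc)

lemma star_tau: "X \<in> B \<Longrightarrow> star (tau X) = tau (star X)"
  by (simp add: star_def tau_mult tau_inv)

lemma tau_canonical: "X \<in> CF \<Longrightarrow> tau X \<in> CF"
  using star_canonical star_star CF_closed by metis

lemma expo_tau: "X \<in> B \<Longrightarrow> expo (tau X) = expo X"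
  by (simp add: tau_def expo_conj)

text \<open>
  The positive word \<open>\<sigma>\<^sub>q\<^sub>-\<^sub>1 \<dots> \<sigma>\<^sub>p\<close>: the
  fundamental word of the strands \<open>p, \<dots>, q\<close>.
\<close>

definition descending_word :: "nat \<Rightarrow> nat \<Rightarrow> braid_word" where
  "descending_word p q = map (\<lambda>i. (i, True)) (rev [p..<q])"

lemma descending_word_valid: "1 \<le> p \<Longrightarrow> q \<le> n \<Longrightarrow> descending_word p q \<in> braid_words n"
  by (auto simp: descending_word_def braid_words_def)

lemma cyc_interval:
  assumes "1 \<le> p" "p \<le> q" "q \<le> n"
  shows "cyc (rev [p..<Suc q]) = braid_of n (descending_word p q)"
  using assms(2,3)
proof (induction q rule: dec_induct)
  case base
  then show ?case by (simp add: descending_word_def braid_of_Nil)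
next
  case (step q)
  have "rev [p..<Suc (Suc q)] = Suc q # q # rev [p..<q]" using step by simp
  moreover have "rev [p..<Suc q] = q # rev [p..<q]" using step by simp
  ultimately have "cyc (rev [p..<Suc (Suc q)]) = gen q \<cdot> braid_of n (descending_word p q)"
    using step by (simp add: cyc_Cons band_base)
  also have "\<dots> = braid_of n ([(q, True)] @ descending_word p q)"
    unfolding gen_def using step assms
    by (subst braid_of_append) (auto intro!: descending_word_valid)
  finally show ?case using step by (simp add: descending_word_def)
qed

lemma delta_word: "\<delta> = braid_of n (descending_word 1 n)"
  using cyc_interval[of 1 n] n_ge_2 by (simp add: delta_def)

text \<open>
  The generator \<open>\<sigma>\<^sub>i\<close> passes the letters above \<open>i + 1\<close>, the
  braid relation with the letters \<open>i + 1, i\<close> turns it into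
  \<open>\<sigma>\<^sub>i\<^sub>+\<^sub>1\<close>, and this passes the letters below
  \<open>i\<close>.
\<close>

lemma gen_descending_word:
  assumes "1 \<le> p" "p \<le> i" "i + 1 < q" "q \<le> n"
  shows "gen i \<cdot> braid_of n (descending_word p q) = braid_of n (descending_word p q) \<cdot> gen (i + 1)"
proof -
  let ?U = "braid_of n (descending_word (i + 2) q)" and ?V = "braid_of n (descending_word p i)"
  have "[p..<q] = [p..<i] @ [i, i + 1] @ [i + 2..<q]"
    using assms upt_add_eq_append[of p i "q - i"] by (simp add: upt_conv_Cons)
  then have w: "descending_word p q =
      descending_word (i + 2) q @ [(i + 1, True)] @ [(i, True)] @ descending_word p i"
    by (simp add: descending_word_def)
  have B: "?U \<in> B" "?V \<in> B" "gen i \<in> B" "gen (i + 1) \<in> B"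
    using assms by (simp_all add: descending_word_valid)
  have eq: "braid_of n (descending_word p q) = ?U \<cdot> (gen (i + 1) \<cdot> (gen i \<cdot> ?V))"
    using assms descending_word_valid[of "i + 2" q] descending_word_valid[of p i]
      braid_of_append[of "descending_word (i + 2) q" "[(i + 1, True)] @ [(i, True)] @ descending_word p i"]
      braid_of_append[of "[(i + 1, True)]" "[(i, True)] @ descending_word p i"]
      braid_of_append[of "[(i, True)]" "descending_word p i"]
    unfolding w gen_def by simp
  have U: "gen i \<cdot> ?U = ?U \<cdot> gen i"
    unfolding gen_def comm_def[symmetric] using assms
    by (intro comm_far_apart) (auto simp: far_apart_def descending_word_def braid_words_def)
  have V: "gen (i + 1) \<cdot> ?V = ?V \<cdot> gen (i + 1)"
    unfolding gen_def comm_def[symmetric] using assms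
    by (intro comm_far_apart) (auto simp: far_apart_def descending_word_def braid_words_def)
  have "gen i \<cdot> braid_of n (descending_word p q) = (gen i \<cdot> ?U) \<cdot> (gen (i + 1) \<cdot> (gen i \<cdot> ?V))"
    unfolding eq using B by (simp add: m_assoc)
  also have "\<dots> = ?U \<cdot> ((gen i \<cdot> (gen (i + 1) \<cdot> gen i)) \<cdot> ?V)"
    unfolding U using B by (simp add: m_assoc)
  also have "gen i \<cdot> (gen (i + 1) \<cdot> gen i) = gen (i + 1) \<cdot> (gen i \<cdot> gen (i + 1))"
    using assms by (intro gen_braid) auto
  also have "?U \<cdot> ((gen (i + 1) \<cdot> (gen i \<cdot> gen (i + 1))) \<cdot> ?V) =
      ?U \<cdot> (gen (i + 1) \<cdot> (gen i \<cdot> (gen (i + 1) \<cdot> ?V)))"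
    using B by (simp add: m_assoc)
  also have "\<dots> = braid_of n (descending_word p q) \<cdot> gen (i + 1)"
    unfolding V eq using B by (simp add: m_assoc)
  finally show ?thesis .
qed

lemma tau_gen:
  assumes "1 \<le> i" "i + 1 < n"
  shows "tau (gen i) = gen (i + 1)"
  using gen_descending_word[of 1 i n] assms unfolding delta_word[symmetric]
  by (intro tau_eq) auto

text \<open>
  The rotation carries the last Artin generator to the first one in two steps, through the side
  \<open>(n 1)\<close> of the polygon.
\<close>

lemma tau_wrap: "tau (gen (n - 1)) = band n n 1" "tau (band n n 1) = gen 1"
proof -
  let ?C = "rev [2..<n]"
  have "[1..<n + 1] = 1 # [2..<n] @ [n]" using n_ge_2 by (simp add: upt_conv_Cons numeral_2_eq_2)
  then have d: "rev [1..<n + 1] = n # ?C @ [1]" by simp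
  have desc: "descending n (n # ?C @ [1])" using delta_descending unfolding d .
  have v: "valid_chord (n, 1)" using n_ge_2 by (simp add: valid_chord_def)
  have desc': "descending n (?C @ [1])" "descending n (n # ?C)"
    using desc by (auto simp: descending_def sorted_wrt_append)
  have B: "cyc (?C @ [1]) \<in> B" "cyc (n # ?C) \<in> B" "band n n 1 \<in> B" "gen (n - 1) \<in> B" "gen 1 \<in> B"
    using desc' v n_ge_2 by auto
  have right: "\<delta> = cyc (?C @ [1]) \<cdot> band n n 1"
    using cyc_extract_right[OF desc] unfolding delta_def d .
  have left: "\<delta> = band n n 1 \<cdot> cyc (n # ?C)"
    using cyc_extract_left[OF desc] unfolding delta_def d .
  have n2: "?C = []" "n - 1 = 1" "band n n 1 = gen 1" if "n = 2"
    using that band_base[of 1] by (simp_all add: numeral_2_eq_2)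
  have first: "\<delta> = gen (n - 1) \<cdot> cyc (?C @ [1])"
  proof (cases "n = 2")
    case True
    show ?thesis unfolding right n2[OF True] using n_ge_2 by simp
  next
    case False
    then have "?C @ [1] = (n - 1) # rev [2..<n - 1] @ [1]"
      using n_ge_2 upt_Suc_append[of 2 "n - 1"] by simp
    then show ?thesis
      using band_base[of "n - 1"] n_ge_2 unfolding delta_def d by (simp add: cyc_Cons)
  qed
  have last: "\<delta> = cyc (n # ?C) \<cdot> gen 1"
  proof (cases "n = 2")
    case True
    show ?thesis unfolding right n2[OF True] using n_ge_2 by simp
  next
    case False
    then have "[2..<n] = 2 # [3..<n]" using n_ge_2 by (simp add: upt_conv_Cons)
    then have e: "n # ?C @ [1] = (n # rev [3..<n]) @ [2, 1]" "n # ?C = (n # rev [3..<n]) @ [2]"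
      by simp_all
    have "band n 2 1 = gen 1" using band_base[of 1] by (simp add: numeral_2_eq_2)
    then show ?thesis
      using cyc_snoc[OF desc[unfolded e(1)]] unfolding delta_def d e by simp
  qed
  have "gen (n - 1) \<cdot> \<delta> = (gen (n - 1) \<cdot> cyc (?C @ [1])) \<cdot> band n n 1"
    unfolding right using B by (simp add: m_assoc)
  then show "tau (gen (n - 1)) = band n n 1"
    using B first by (intro tau_eq) auto
  have "band n n 1 \<cdot> \<delta> = (band n n 1 \<cdot> cyc (n # ?C)) \<cdot> gen 1"
    unfolding last using B by (simp add: m_assoc)
  then show "tau (band n n 1) = gen 1"
    using B left by (intro tau_eq) auto
qed

lemma tau_pow_closed [simp]: "X \<in> B \<Longrightarrow> (tau ^^ k) X \<in> B"
  by (induction k) auto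

lemma tau_pow_mult: "X \<in> B \<Longrightarrow> Y \<in> B \<Longrightarrow> (tau ^^ k) (X \<cdot> Y) = (tau ^^ k) X \<cdot> (tau ^^ k) Y"
  by (induction k) (auto simp: tau_mult)

lemma tau_pow_inv: "X \<in> B \<Longrightarrow> (tau ^^ k) (\<i> X) = \<i> ((tau ^^ k) X)"
  by (induction k) (auto simp: tau_inv)

lemma tau_pow_one: "(tau ^^ k) \<e> = \<e>"
  by (induction k) (auto simp: tau_def)

lemma tau_pow_gen: "1 \<le> i \<Longrightarrow> i < n \<Longrightarrow> (tau ^^ (i - 1)) (gen 1) = gen i"
proof -
  have *: "Suc k < n \<Longrightarrow> (tau ^^ k) (gen 1) = gen (Suc k)" for k
    using tau_gen by (induction k) auto
  assume "1 \<le> i" "i < n"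
  then show ?thesis using *[of "i - 1"] by simp
qed

text \<open>
  The power \<open>\<delta>\<^sup>n\<close> is central: the rotation permutes the \<open>n\<close>
  sides of the polygon cyclically, and the half twists along the sides generate the braid group.
\<close>

lemma tau_pow_n:
  assumes "X \<in> B"
  shows "(tau ^^ n) X = X"
proof -
  have "(tau ^^ n) (gen 1) = (tau ^^ Suc (Suc (n - 1 - 1))) (gen 1)"
    using n_ge_2 by (simp add: numeral_2_eq_2 Suc_diff_Suc del: funpow.simps)
  also have "\<dots> = tau (tau (gen (n - 1)))"
    using tau_pow_gen[of "n - 1"] n_ge_2 by simp
  finally have one: "(tau ^^ n) (gen 1) = gen 1" by (simp only: tau_wrap)
  have gen: "(tau ^^ n) (gen i) = gen i" if i: "1 \<le> i" "i < n" for i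
  proof -
    have "(tau ^^ n) ((tau ^^ (i - 1)) (gen 1)) = (tau ^^ (i - 1)) ((tau ^^ n) (gen 1))"
      using arg_cong[OF add.commute[of n "i - 1"], of "\<lambda>k. (tau ^^ k) (gen 1)"]
      unfolding funpow_add comp_apply .
    then show ?thesis by (simp only: one tau_pow_gen[OF i])
  qed
  have "(tau ^^ n) (braid_of n w) = braid_of n w" if "w \<in> braid_words n" for w
    using that
  proof (induction w)
    case Nil
    then show ?case by (simp add: braid_of_Nil tau_pow_one)
  next
    case (Cons a w)
    obtain i e where a: "a = (i, e)" by fastforce
    have i: "1 \<le> i" "i < n" and w: "w \<in> braid_words n" using Cons.prems by (auto simp: a)
    have "(tau ^^ n) (braid_of n [a]) = braid_of n [a]"
      using i gen[OF i] by (cases e) (simp_all add: a braid_of_False tau_pow_inv gen_def[symmetric])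
    moreover have "braid_of n (a # w) = braid_of n [a] \<cdot> braid_of n w" "braid_of n [a] \<in> B"
      using braid_of_append[of "[a]" w] i w by (simp_all add: a)
    ultimately show ?case using Cons.IH w by (simp add: tau_pow_mult)
  qed
  then show ?thesis using assms by (auto simp: carrier_braid_group)
qed

lemma tau_pow_canonical: "X \<in> CF \<Longrightarrow> (tau ^^ k) X \<in> CF"
  by (induction k) (auto intro: tau_canonical)

lemma tau_surj:
  assumes "X \<in> B"
  obtains Y where "Y \<in> B" "X = tau Y" "X \<in> CF \<Longrightarrow> Y \<in> CF"
proof -
  let ?Y = "(tau ^^ (n - 1)) X"
  have "tau ?Y = (tau ^^ Suc (n - 1)) X" by simp
  also have "\<dots> = X" using tau_pow_n[OF assms] n_ge_2 by simp
  finally show ?thesis using that[of ?Y] assms tau_pow_canonical by auto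
qed

lemma tau_inj: "X \<in> B \<Longrightarrow> Y \<in> B \<Longrightarrow> tau X = tau Y \<Longrightarrow> X = Y"
  unfolding tau_def conj_by_def by simp

lemma tau_canonical_iff: "X \<in> B \<Longrightarrow> tau X \<in> CF \<longleftrightarrow> X \<in> CF"
  using tau_surj tau_inj tau_canonical by (metis tau_closed)

section \<open>Invariant sets of permutations\<close>

text \<open>
  The unions of cycles of a permutation of \<open>{1..n}\<close>. Their number, a power of two,
  replaces the number of cycles: it at most halves when a transposition is multiplied on, and this
  needs no case distinction between merging and splitting cycles.
\<close>

definition invariant_sets :: "(nat \<Rightarrow> nat) \<Rightarrow> nat set set" where
  "invariant_sets f = {I. I \<subseteq> {1..n} \<and> (\<forall>i. f i \<in> I \<longleftrightarrow> i \<in> I)}"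

lemma finite_invariant_sets: "finite (invariant_sets f)"
  by (rule finite_subset[of _ "Pow {1..n}"]) (auto simp: invariant_sets_def)

lemma card_invariant_sets_separated:
  "card (invariant_sets f) \<le> 2 * card {I \<in> invariant_sets f. t \<in> I \<longleftrightarrow> s \<in> I}"
  by (intro card_separated_sets finite_invariant_sets) (auto simp: invariant_sets_def)

lemma invariant_sets_transpose:
  assumes "I \<in> invariant_sets f" "t \<in> I \<longleftrightarrow> s \<in> I"
  shows "I \<in> invariant_sets (f \<circ> transpose t s)" "I \<in> invariant_sets (transpose t s \<circ> f)"
proof -
  have "transpose t s k \<in> I \<longleftrightarrow> k \<in> I" for k
    using assms(2) by (cases "k = t"; cases "k = s") simp_all
  then show "I \<in> invariant_sets (f \<circ> transpose t s)" "I \<in> invariant_sets (transpose t s \<circ> f)"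
    using assms(1) by (simp_all add: invariant_sets_def)
qed

lemma card_invariant_sets_mult:
  assumes "X \<in> B" "valid_chords ps"
  shows "card (invariant_sets (perm X)) \<le>
    2 ^ length ps * card (invariant_sets (perm (X \<cdot> bands ps)))"
  using assms
proof (induction ps arbitrary: X)
  case (Cons p ps)
  obtain t s where p: "p = (t, s)" by fastforce
  have v: "valid_chord (t, s)" "valid_chords ps" using Cons.prems by (auto simp: p)
  let ?F = "invariant_sets (perm X)" and ?G = "invariant_sets (perm (X \<cdot> band n t s))"
  have "perm (X \<cdot> band n t s) = perm X \<circ> transpose t s"
    using v Cons.prems(1) by (simp add: perm_mult perm_band valid_chord_def)
  then have "{I \<in> ?F. t \<in> I \<longleftrightarrow> s \<in> I} \<subseteq> ?G"
    using invariant_sets_transpose(1) by auto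
  then have "card {I \<in> ?F. t \<in> I \<longleftrightarrow> s \<in> I} \<le> card ?G"
    by (intro card_mono finite_invariant_sets)
  then have "card ?F \<le> 2 * card ?G"
    using card_invariant_sets_separated[of "perm X" t s] by linarith
  also have "card ?G \<le> 2 ^ length ps * card (invariant_sets (perm (X \<cdot> band n t s \<cdot> bands ps)))"
    using v Cons.prems(1) by (intro Cons.IH) auto
  finally show ?case using v Cons.prems(1) by (simp add: p m_assoc)
qed simp

lemma perm_cyc_interval:
  assumes "1 \<le> p" "p \<le> q" "q \<le> n"
  shows "perm (cyc (rev [p..<Suc q])) i = (if i = p then q else if p < i \<and> i \<le> q then i - 1 else i)"
  using assms(2,3)
proof (induction q arbitrary: i rule: dec_induct)
  case base
  then show ?case by simp
next
  case (step q)
  have "rev [p..<Suc (Suc q)] = Suc q # q # rev [p..<q]" "rev [p..<Suc q] = q # rev [p..<q]"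
    using step by simp_all
  moreover have "descending n (rev [p..<Suc q])"
    using step assms by (auto simp: descending_def sorted_wrt_rev simp del: upt_Suc)
  ultimately have "perm (cyc (rev [p..<Suc (Suc q)])) = transpose (Suc q) q \<circ> perm (cyc (rev [p..<Suc q]))"
    using step assms cyc_closed[of "rev [p..<Suc q]"] by (simp add: cyc_Cons perm_mult perm_band)
  then show ?case
    using step assms by (auto simp: transpose_def simp del: upt_Suc)
qed

lemma perm_delta: "perm \<delta> i = (if i = 1 then n else if 1 < i \<and> i \<le> n then i - 1 else i)"
  using perm_cyc_interval[of 1 n i] n_ge_2 by (simp add: delta_def)

lemma invariant_sets_delta: "invariant_sets (perm \<delta>) \<subseteq> {{}, {1..n}}"
proof
  fix I assume I: "I \<in> invariant_sets (perm \<delta>)"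
  have "i \<in> I \<longleftrightarrow> 1 \<in> I" if "1 \<le> i" "i \<le> n" for i
    using that
  proof (induction i rule: dec_induct)
    case (step i)
    have "perm \<delta> (Suc i) = i" using step by (simp add: perm_delta)
    moreover have "perm \<delta> (Suc i) \<in> I \<longleftrightarrow> Suc i \<in> I"
      using I unfolding invariant_sets_def by blast
    ultimately have "Suc i \<in> I \<longleftrightarrow> i \<in> I" by simp
    then show ?case using step by simp
  qed simp
  moreover have "I \<subseteq> {1..n}" using I by (simp add: invariant_sets_def)
  ultimately have "I = (if 1 \<in> I then {1..n} else {})" by (auto split: if_splits)
  then show "I \<in> {{}, {1..n}}" by (metis insertCI)
qed

text \<open>
  Since \<open>Y\<close> can be completed to \<open>\<delta>\<close> by \<open>n - 1 - expo
  Y\<close> bands and \<open>\<delta>\<close> has only two invariant sets, the permutation of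
  \<open>Y\<close> has at most \<open>n - expo Y\<close> cycles.
\<close>

lemma card_invariant_sets_canonical:
  assumes "Y \<in> CF"
  shows "card (invariant_sets (perm Y)) * 2 ^ nat (expo Y) \<le> 2 ^ n"
proof -
  obtain ps where ps: "valid_chords ps" "star Y = bands ps" "expo (star Y) = int (length ps)"
    using CF_bands[OF star_canonical[OF assms]] by blast
  have B: "Y \<in> B" using assms by simp
  have len: "n = Suc (length ps + nat (expo Y))"
    using ps(3) CF_expo(1,2)[OF assms] n_ge_2 by (simp add: expo_star B)
  have "card (invariant_sets (perm \<delta>)) \<le> card {{}, {1..n}}"
    using invariant_sets_delta by (intro card_mono) auto
  also have "\<dots> \<le> 2" by (simp add: card_insert_if)
  finally have "card (invariant_sets (perm \<delta>)) \<le> 2" .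
  moreover have "card (invariant_sets (perm Y)) \<le> 2 ^ length ps * card (invariant_sets (perm \<delta>))"
    using card_invariant_sets_mult[OF B ps(1)] ps(2)[symmetric] B by simp
  ultimately have "card (invariant_sets (perm Y)) \<le> 2 ^ length ps * 2"
    using mult_le_mono2 order_trans by blast
  then have "card (invariant_sets (perm Y)) * 2 ^ nat (expo Y) \<le> 2 ^ length ps * 2 * 2 ^ nat (expo Y)"
    by (rule mult_le_mono1)
  also have "\<dots> = 2 ^ Suc (length ps + nat (expo Y))" by (simp add: power_add)
  also have "\<dots> = 2 ^ n" by (simp only: len[symmetric])
  finally show ?thesis .
qed

text \<open>
  The quotient \<open>C\<close> is a product of \<open>expo Y - 1\<close> bands and so has at least
  twice as many invariant sets as \<open>Y\<close> can have. At least half of them do not separate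
  \<open>t\<close> from \<open>s\<close>; these are invariant under \<open>Y\<close> as well and
  therefore exhaust the invariant sets of \<open>Y\<close>.
\<close>

lemma canonical_divisor_invariant:
  assumes Y: "Y \<in> CF" and C: "\<i> (band n t s) \<cdot> Y \<in> CF" and v: "valid_chord (t, s)"
    and I: "I \<in> invariant_sets (perm Y)"
  shows "t \<in> I \<longleftrightarrow> s \<in> I"
proof -
  define C where "C = \<i> (band n t s) \<cdot> Y"
  let ?FY = "invariant_sets (perm Y)" and ?FC = "invariant_sets (perm C)"
  let ?GY = "{I \<in> ?FY. t \<in> I \<longleftrightarrow> s \<in> I}" and ?GC = "{I \<in> ?FC. t \<in> I \<longleftrightarrow> s \<in> I}"
  have B: "C \<in> B" "Y \<in> B" "band n t s \<in> B" using Y C v by (auto simp: C_def)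
  have Yeq: "Y = band n t s \<cdot> C" using B by (simp add: C_def)
  obtain ps where ps: "valid_chords ps" "C = bands ps" "expo C = int (length ps)"
    using CF_bands[OF C] unfolding C_def by blast
  have eY: "nat (expo Y) = Suc (length ps)"
    using ps(3) B v by (subst Yeq) (simp add: expo_mult expo_band valid_chord_def)
  have "invariant_sets id = Pow {1..n}" by (auto simp: invariant_sets_def)
  then have "2 ^ n \<le> 2 ^ length ps * card ?FC"
    using card_invariant_sets_mult[of \<e> ps] ps by (simp add: card_Pow)
  also have "\<dots> \<le> 2 ^ length ps * (2 * card ?GC)"
    using card_invariant_sets_separated by (intro mult_le_mono2)
  also have "card ?GC \<le> card ?GY"
  proof (rule card_mono)
    have "perm Y = transpose t s \<circ> perm C"
      using B v by (subst Yeq) (simp add: perm_mult perm_band valid_chord_def)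
    then show "?GC \<subseteq> ?GY" using invariant_sets_transpose(2) by auto
  qed (use finite_invariant_sets in auto)
  finally have "2 ^ n \<le> card ?GY * 2 ^ nat (expo Y)"
    by (simp add: eY mult_ac)
  with card_invariant_sets_canonical[OF Y]
  have "card ?FY * 2 ^ nat (expo Y) \<le> card ?GY * 2 ^ nat (expo Y)"
    by (rule order_trans)
  then have "card ?FY \<le> card ?GY" by simp
  then have "?GY = ?FY"
    using finite_invariant_sets card_mono[of ?FY ?GY] by (intro card_subset_eq) auto
  then show ?thesis using I by blast
qed

lemma perm_bands_invariant:
  assumes "valid_chords ps" "\<forall>(u, v)\<in>set ps. u \<in> I \<longleftrightarrow> v \<in> I"
  shows "perm (bands ps) k \<in> I \<longleftrightarrow> k \<in> I"
  using assms
proof (induction ps)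
  case (Cons p ps)
  obtain u v where p: "p = (u, v)" by fastforce
  have "perm (bands (p # ps)) = transpose u v \<circ> perm (bands ps)"
    using Cons.prems by (simp add: p perm_mult perm_band valid_chord_def)
  moreover have "transpose u v k \<in> I \<longleftrightarrow> k \<in> I" for k
    using Cons.prems by (cases "k = u"; cases "k = v") (simp_all add: p)
  ultimately show ?case using Cons by simp
qed simp

lemma bands_invariant_set:
  assumes "valid_chords ps" "I \<subseteq> {1..n}" "\<forall>(u, v)\<in>set ps. u \<in> I \<longleftrightarrow> v \<in> I"
  shows "I \<in> invariant_sets (perm (bands ps))"
  using perm_bands_invariant[OF assms(1,3)] assms(2) unfolding invariant_sets_def by blast

lemma noncrossing_disjoint: "noncrossing (t, s) (u, v) \<Longrightarrow> {t, s} \<inter> {u, v} = {}"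
  by (auto simp: noncrossing_def)

lemma divisor_of_noncrossing_bands:
  assumes ps: "valid_chords ps" "sorted_wrt noncrossing ps" and v: "valid_chord (t, s)"
    and div: "\<i> (band n t s) \<cdot> bands ps \<in> CF"
  shows "(t, s) \<in> set ps"
proof -
  note inv = canonical_divisor_invariant[OF noncrossing_bands_canonical[OF ps] div v]
  have ts: "1 \<le> s" "s < t" "t \<le> n" using v by (auto simp: valid_chord_def)
  \<comment> \<open>If no chord ended at \<open>t\<close>, the set \<open>{t}\<close> would be invariant, and so contain \<open>s\<close>.\<close>
  obtain u w where uw: "(u, w) \<in> set ps" "t \<in> {u, w}"
  proof (rule ccontr)
    assume *: "\<not> thesis"
    have "{t} \<in> invariant_sets (perm (bands ps))"
      using ps(1) ts that * by (intro bands_invariant_set) auto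
    then show False using inv ts by auto
  qed
  have uw': "1 \<le> w" "w < u" "u \<le> n" using uw ps by (auto simp: valid_chord_def)
  have "a \<in> {u, w} \<longleftrightarrow> b \<in> {u, w}" if "(a, b) \<in> set ps" for a b
    using noncrossing_pairs[OF ps(2) that uw(1)] noncrossing_disjoint[of a b u w] by auto
  then have "{u, w} \<in> invariant_sets (perm (bands ps))"
    using ps(1) uw' by (intro bands_invariant_set) auto
  then have "s \<in> {u, w}" using inv uw(2) by blast
  then show ?thesis using uw ts uw' by auto
qed

text \<open>
  Each chord \<open>(t, s)\<close> of the product cuts the polygon, and the permutation of the
  complement preserves the part \<open>{s<..t}\<close>: \<open>\<delta>\<close> shifts this set to
  \<open>{s..<t}\<close>, and the transposition \<open>(t s)\<close> shifts it back. So
  \<open>j\<close> and \<open>l\<close> lie in the same part, which says equivalently that the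
  interval \<open>{l..<j}\<close> does not separate \<open>t\<close> from \<open>s\<close>.
\<close>

lemma divisor_of_complement:
  assumes ps: "valid_chords ps" "sorted_wrt noncrossing ps" and v: "valid_chord (j, l)"
    and div: "\<i> (band n j l) \<cdot> star (bands ps) \<in> CF" and ts: "(t, s) \<in> set ps"
  shows "t \<in> {l..<j} \<longleftrightarrow> s \<in> {l..<j}"
proof -
  have ts': "1 \<le> s" "s < t" "t \<le> n" using ts ps by (auto simp: valid_chord_def)
  obtain L R where LR: "ps = L @ (t, s) # R" using ts split_list by fastforce
  have vLR: "valid_chords L" "valid_chords R" "valid_chord (t, s)" using ps by (auto simp: LR)
  have "noncrossing (u, w) (t, s)" if "(u, w) \<in> set L \<union> set R" for u w
    using ps(2) that noncrossing_commute[of "(t, s)" "(u, w)"] by (auto simp: LR sorted_wrt_append)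
  then have sides: "(u \<in> {s<..t} \<longleftrightarrow> w \<in> {s<..t}) \<and> (u \<in> {s..<t} \<longleftrightarrow> w \<in> {s..<t})"
    if "(u, w) \<in> set L \<union> set R" for u w
  proof -
    have "w < u" using that vLR by (auto simp: valid_chord_def)
    with \<open>\<And>u w. (u, w) \<in> set L \<union> set R \<Longrightarrow> noncrossing (u, w) (t, s)\<close>[OF that] ts'(2)
    show ?thesis by (auto simp: noncrossing_iff)
  qed
  have perm: "perm (bands ps) = perm (bands L) \<circ> (transpose t s \<circ> perm (bands R))"
    using vLR by (simp add: LR bands_append perm_mult perm_band valid_chord_def)
  have swap: "perm (bands ps) k \<in> {s..<t} \<longleftrightarrow> k \<in> {s<..t}" for k
  proof -
    have "perm (bands ps) k \<in> {s..<t} \<longleftrightarrow> transpose t s (perm (bands R) k) \<in> {s..<t}"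
      unfolding perm comp_apply using vLR sides by (intro perm_bands_invariant) auto
    also have "\<dots> \<longleftrightarrow> perm (bands R) k \<in> {s<..t}"
      using ts' by (auto simp: transpose_def)
    also have "\<dots> \<longleftrightarrow> k \<in> {s<..t}"
      using vLR sides by (intro perm_bands_invariant) auto
    finally show ?thesis .
  qed
  have "perm (bands ps) (perm (star (bands ps)) i) = perm \<delta> i" for i
    using perm_mult[of "bands ps" "star (bands ps)"] ps(1) by (simp add: fun_eq_iff)
  then have "perm (star (bands ps)) i \<in> {s<..t} \<longleftrightarrow> i \<in> {s<..t}" for i
    using swap[of "perm (star (bands ps)) i"] ts' by (auto simp: perm_delta split: if_splits)
  then have "{s<..t} \<in> invariant_sets (perm (star (bands ps)))"
  proof -
    have "{s<..t} \<subseteq> {1..n}" using ts' by auto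
    with \<open>\<And>i. perm (star (bands ps)) i \<in> {s<..t} \<longleftrightarrow> i \<in> {s<..t}\<close> show ?thesis
      unfolding invariant_sets_def by blast
  qed
  then have "j \<in> {s<..t} \<longleftrightarrow> l \<in> {s<..t}"
    using canonical_divisor_invariant[OF star_canonical[OF noncrossing_bands_canonical[OF ps]] div v]
    by blast
  then show ?thesis using v ts' by (auto simp: valid_chord_def)
qed

section \<open>Left normal pairs\<close>

definition no_common_divisor :: "braid \<Rightarrow> braid \<Rightarrow> bool" where
  "no_common_divisor X Y \<longleftrightarrow> \<not> (\<exists>t s. valid_chord (t, s) \<and>
    \<i> (band n t s) \<cdot> X \<in> CF \<and> \<i> (band n t s) \<cdot> Y \<in> CF)"

text \<open>
  Bands are exactly the canonical factors with exponent sum \<open>1\<close>, so the rotation, being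
  bijective on canonical factors, also has a band as preimage of a band.
\<close>

lemma no_common_divisor_tau:
  assumes "X \<in> B" "Y \<in> B" "no_common_divisor X Y"
  shows "no_common_divisor (tau X) (tau Y)"
  unfolding no_common_divisor_def
proof clarify
  fix t s assume v: "valid_chord (t, s)"
    and X: "\<i> (band n t s) \<cdot> tau X \<in> CF" and Y: "\<i> (band n t s) \<cdot> tau Y \<in> CF"
  obtain a where a: "a \<in> B" "band n t s = tau a" "a \<in> CF"
    using tau_surj[of "band n t s"] band_canonical[OF v] v by (metis valid_band_closed)
  have "expo (tau a) = 1" using v by (simp add: a(2)[symmetric] expo_band valid_chord_def)
  then have "expo a = 1" using expo_tau a(1) by simp
  then obtain u w where uw: "valid_chord (u, w)" "a = band n u w" using CF_expo(5)[OF a(3)] by blast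
  have "tau (\<i> a \<cdot> X) \<in> CF" "tau (\<i> a \<cdot> Y) \<in> CF"
    using X Y a assms by (simp_all add: tau_mult tau_inv)
  then have "\<i> a \<cdot> X \<in> CF" "\<i> a \<cdot> Y \<in> CF"
    using tau_canonical_iff a assms by auto
  then show False using assms(3) uw by (auto simp: no_common_divisor_def)
qed

text \<open>
  In terms of complements, the left normal position of a pair becomes symmetric: by
  \<open>star_canonical\<close>, if \<open>X (j l)\<close> is canonical, then so is \<open>star (X
  (j l)) = (j l)\<^sup>-\<^sup>1 (star X)\<close>.
\<close>

definition left_weighted :: "braid \<Rightarrow> braid \<Rightarrow> bool" where
  "left_weighted X Y \<longleftrightarrow> X \<in> CF - {\<e>, \<delta>} \<and> Y \<in> CF - {\<e>, \<delta>} \<and> no_common_divisor (star X) Y"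

lemma left_weighted_tau:
  assumes "left_weighted X Y"
  shows "left_weighted (tau X) (tau Y)"
proof -
  have XY: "X \<in> CF" "Y \<in> CF" "X \<noteq> \<e>" "X \<noteq> \<delta>" "Y \<noteq> \<e>" "Y \<noteq> \<delta>" "no_common_divisor (star X) Y"
    using assms by (auto simp: left_weighted_def)
  have "tau \<e> = \<e>" using tau_pow_one[of 1] by simp
  then have "tau Z \<noteq> \<e>" "tau Z \<noteq> \<delta>" if "Z \<in> CF" "Z \<noteq> \<e>" "Z \<noteq> \<delta>" for Z
    using tau_inj[of Z \<e>] tau_inj[of Z \<delta>] that by auto
  then show ?thesis
    using XY no_common_divisor_tau[of "star X" Y] tau_canonical
    by (auto simp: left_weighted_def star_tau)
qed

lemma left_weighted_left_normal:
  assumes "left_weighted X Y"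
  shows "left_normal n k [X, Y]"
proof -
  have XY: "X \<in> CF" "Y \<in> CF" "X \<noteq> \<e>" "X \<noteq> \<delta>" "Y \<noteq> \<e>" "Y \<noteq> \<delta>" "no_common_divisor (star X) Y"
    using assms by (auto simp: left_weighted_def)
  have "\<not> (X \<cdot> band n j l \<in> CF \<and> \<i> (band n j l) \<cdot> Y \<in> CF)" if "1 \<le> l" "l < j" "j \<le> n" for j l
  proof clarify
    assume c: "X \<cdot> band n j l \<in> CF" "\<i> (band n j l) \<cdot> Y \<in> CF"
    have v: "valid_chord (j, l)" using that by (simp add: valid_chord_def)
    have "star (X \<cdot> band n j l) = \<i> (band n j l) \<cdot> star X"
      using XY v by (simp add: star_def inv_mult_group m_assoc)
    then have "\<i> (band n j l) \<cdot> star X \<in> CF" using star_canonical[OF c(1)] by simp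
    then show False using XY(7) v c(2) by (auto simp: no_common_divisor_def)
  qed
  then show ?thesis
    unfolding left_normal_def using XY by (auto simp: less_Suc_eq)
qed

lemma delta_int_pow: "\<delta> [^]\<^bsub>braid_group n\<^esub> (- 1 :: int) = \<i> \<delta>" "\<delta> [^]\<^bsub>braid_group n\<^esub> (1 :: int) = \<delta>"
  using int_pow_neg[of \<delta> 1] int_pow_1[of \<delta>] by auto

lemma cycle_two_factors:
  "X \<in> B \<Longrightarrow> cycle_factors n (- 1) [X, Y] = [Y, tau X]"
  by (simp add: delta_int_pow tau_def conj_by_def)

text \<open>
  Cycling turns the factors \<open>X, Y\<close> into \<open>Y, tau X\<close>, then into \<open>tau
  X, tau Y\<close>. So all iterates are covered by the two hypotheses and their rotations, and
  \<open>2 n\<close> iterations lead back to the start.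
\<close>

lemma rigid_recurrent:
  assumes "left_weighted X Y" "left_weighted Y (tau X)"
  defines "x \<equiv> normal_form_value n (- 1) [X, Y]"
  shows "has_left_normal_form n x (- 1) [X, Y]" "rigid n x" "\<exists>d\<ge>1. (cycling n ^^ d) x x"
proof -
  have B: "X \<in> B" "Y \<in> B" using assms by (auto simp: left_weighted_def)
  show lnf: "has_left_normal_form n x (- 1) [X, Y]"
    using left_weighted_left_normal[OF assms(1)] by (simp add: has_left_normal_form_def x_def)
  have "left_normal n (- 1) (cycle_factors n (- 1) [X, Y])"
    using left_weighted_left_normal[OF assms(2)] B by (simp only: cycle_two_factors)
  then show "rigid n x" using lnf by (auto simp only: rigid_def)
  \<comment> \<open>The factors that pass through the front position: \<open>X, Y, tau X, tau Y, \<dots>\<close>\<close>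
  define f where "f i = (tau ^^ (i div 2)) (if even i then X else Y)" for i
  have f_Suc: "f (Suc (Suc i)) = tau (f i)" for i by (simp add: f_def)
  have fB: "f i \<in> B" for i using B by (simp add: f_def)
  have lw: "left_weighted (f i) (f (Suc i)) \<and> left_weighted (f (Suc i)) (f (Suc (Suc i)))" for i
  proof (induction i)
    case 0
    then show ?case using assms by (simp add: f_def)
  next
    case (Suc i)
    then show ?case using left_weighted_tau[of "f i" "f (Suc i)"] by (simp add: f_Suc)
  qed
  \<comment> \<open>The \<open>i\<close>-th iterate of cycling.\<close>
  define y where "y i = normal_form_value n (- 1) [f i, f (Suc i)]" for i
  have "cycling n (y i) (y (Suc i))" for i
    unfolding cycling_def
  proof (intro exI conjI)
    show "has_left_normal_form n (y i) (- 1) [f i, f (Suc i)]"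
      using lw left_weighted_left_normal by (simp add: has_left_normal_form_def y_def)
    show "y (Suc i) = normal_form_value n (- 1) (cycle_factors n (- 1) [f i, f (Suc i)])"
      unfolding cycle_two_factors[OF fB] by (simp add: y_def f_Suc)
  qed
  then have "(cycling n ^^ d) (y 0) (y d)" for d
    by (induction d) auto
  moreover have "f (2 * n) = f 0" "f (Suc (2 * n)) = f 1"
    using tau_pow_n B by (simp_all add: f_def)
  then have "y (2 * n) = y 0" by (simp add: y_def)
  moreover have "y 0 = x" by (simp add: y_def x_def f_def)
  ultimately have "(cycling n ^^ (2 * n)) x x" by metis
  then show "\<exists>d\<ge>1. (cycling n ^^ d) x x"
    using n_ge_2 by (intro exI[of _ "2 * n"]) auto
qed

section \<open>Super summit sets of braids with exponent sum zero\<close>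

lemma expo_braid_prod: "set bs \<subseteq> B \<Longrightarrow> expo (braid_prod n bs) = sum_list (map expo bs)"
  by (induction bs) (auto simp: expo_mult)

text \<open>
  A proper canonical factor has exponent sum between \<open>1\<close> and \<open>n - 2\<close>. With
  total exponent sum \<open>0\<close>, a nonnegative power of \<open>\<delta>\<close> leaves no room
  for any factor, and for a negative one the factors must contribute at least \<open>n - 1\<close>,
  more than a single factor can.
\<close>

lemma normal_form_bounds:
  assumes "has_left_normal_form n y k bs" "expo y = 0" "y \<noteq> \<e>"
  shows "k \<le> - 1" "2 \<le> length bs"
proof -
  have bs: "b \<in> CF" "b \<noteq> \<e>" "b \<noteq> \<delta>" if "b \<in> set bs" for b
    using assms(1) that by (auto simp: has_left_normal_form_def left_normal_def)
  have y: "y = \<delta> [^]\<^bsub>braid_group n\<^esub> k \<cdot> braid_prod n bs"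
    using assms(1) by (simp add: has_left_normal_form_def normal_form_value_def)
  have B: "set bs \<subseteq> B" using bs by auto
  have "expo b \<ge> 1" "expo b \<le> int n - 2" if "b \<in> set bs" for b
    using CF_expo[OF bs(1)[OF that]] bs(2,3)[OF that] by fastforce+
  then have "\<forall>x\<in>set (map expo bs). 1 \<le> x \<and> x \<le> int n - 2" by simp
  from sum_list_between[OF this]
  have len: "int (length bs) \<le> sum_list (map expo bs)"
    "sum_list (map expo bs) \<le> int (length bs) * (int n - 2)"
    by simp_all
  have sum: "k * (int n - 1) + sum_list (map expo bs) = 0"
    using assms(2) B by (simp add: y expo_mult expo_pow expo_delta expo_braid_prod)
  show k: "k \<le> - 1"
  proof (rule ccontr)
    assume "\<not> k \<le> - 1"
    then have "k * (int n - 1) \<ge> 0" using n_ge_2 by simp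
    then have "length bs = 0" "k * (int n - 1) = 0" using len sum by linarith+
    then have "bs = []" "k = 0" using n_ge_2 by auto
    then show False using assms(3) y by simp
  qed
  have "(- k) * (int n - 1) \<ge> 1 * (int n - 1)" using k n_ge_2 by (intro mult_right_mono) auto
  then have "int n - 1 \<le> int (length bs) * (int n - 2)" using len sum by simp
  moreover have "length bs = 0 \<or> length bs = 1 \<or> 2 \<le> length bs" by linarith
  ultimately show "2 \<le> length bs" using n_ge_2 by auto
qed

lemma ultra_summit_rigid:
  assumes b: "b \<in> B" "expo b = 0" "b \<noteq> \<e>"
    and XY: "left_weighted X Y" "left_weighted Y (tau X)"
    and conjugate: "conjugate b (normal_form_value n (- 1) [X, Y])"
  shows "normal_form_value n (- 1) [X, Y] \<in> {x \<in> ultra_summit_set n b. rigid n x}"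
proof -
  let ?x = "normal_form_value n (- 1) [X, Y]"
  note rr = rigid_recurrent[OF XY]
  have "k' \<le> - 1 \<and> length [X, Y] \<le> length bs'"
    if y: "y \<in> conjugates n b" "has_left_normal_form n y k' bs'" for y k' bs'
  proof -
    obtain g where g: "g \<in> B" "y = conj_by g b" using y(1) unfolding conjugate_iff conjugate_def by blast
    have "expo y = 0" using g b by (simp add: expo_conj)
    moreover have "y \<noteq> \<e>"
    proof
      assume "y = \<e>"
      then have "g \<cdot> b = g" using g b conj_eq_iff[of g b \<e>] by simp
      then show False using g b by simp
    qed
    ultimately show ?thesis using normal_form_bounds[OF y(2)] by simp
  qed
  then have min: "\<forall>y\<in>conjugates n b. \<forall>k' bs'. has_left_normal_form n y k' bs' \<longrightarrow>
      k' \<le> - 1 \<and> length [X, Y] \<le> length bs'"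
    by blast
  have "?x \<in> super_summit_set n b"
    unfolding super_summit_set_def
  proof (intro CollectI conjI exI)
    show "?x \<in> conjugates n b" using conjugate by (simp only: conjugate_iff)
  qed (rule rr(1) min)+
  then show ?thesis unfolding ultra_summit_set_def using rr by blast
qed

end

section \<open>Noncrossing Hamiltonian paths\<close>

text \<open>
  A list of choices \<open>bs\<close> describes a path from \<open>w\<close> through the vertices
  \<open>w, \<dots>, w + 2 * length bs\<close>: each choice adds two edges \<open>w -- x --
  y\<close>, with \<open>x, y\<close> the two lowest unvisited vertices for
  \<^const>\<open>False\<close>, and \<open>x\<close> the highest, \<open>y\<close> the lowest
  unvisited vertex for \<^const>\<open>True\<close>. In both cases the unvisited vertices are again
  those directly above \<open>y\<close>. The edges \<open>w -- x\<close> are listed here, the edges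
  \<open>x -- y\<close> in \<open>second_edges\<close>, and the vertices \<open>x\<close> in
  \<open>midpoints\<close>.
\<close>

fun first_edges :: "bool list \<Rightarrow> nat \<Rightarrow> (nat \<times> nat) list" where
  "first_edges [] w = []"
| "first_edges (b # bs) w =
    (if b then (w + 2 * length bs + 2, w) # first_edges bs (w + 1)
     else (w + 1, w) # first_edges bs (w + 2))"

fun second_edges :: "bool list \<Rightarrow> nat \<Rightarrow> (nat \<times> nat) list" where
  "second_edges [] w = []"
| "second_edges (b # bs) w =
    (if b then (w + 2 * length bs + 2, w + 1) # second_edges bs (w + 1)
     else (w + 2, w + 1) # second_edges bs (w + 2))"

fun midpoints :: "bool list \<Rightarrow> nat \<Rightarrow> nat list" where
  "midpoints [] w = []"
| "midpoints (b # bs) w =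
    (if b then (w + 2 * length bs + 2) # midpoints bs (w + 1) else (w + 1) # midpoints bs (w + 2))"

lemma length_edges [simp]:
  "length (first_edges bs w) = length bs" "length (second_edges bs w) = length bs"
  "length (midpoints bs w) = length bs"
  by (induction bs arbitrary: w) auto

lemma first_edges_bounds:
  "(t, s) \<in> set (first_edges bs w) \<Longrightarrow> w \<le> s \<and> s < t \<and> t \<le> w + 2 * length bs"
proof (induction bs arbitrary: w)
  case (Cons b bs)
  then show ?case by (cases b) (auto dest!: Cons.IH)
qed simp

lemma second_edges_bounds:
  "(t, s) \<in> set (second_edges bs w) \<Longrightarrow> w < s \<and> s < t \<and> t \<le> w + 2 * length bs"
proof (induction bs arbitrary: w)
  case (Cons b bs)
  then show ?case by (cases b) (auto dest!: Cons.IH)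
qed simp

lemma first_edges_noncrossing: "sorted_wrt noncrossing (first_edges bs w)"
proof (induction bs arbitrary: w)
  case (Cons b bs)
  have "noncrossing (w + 2 * length bs + 2, w) (u, v)" if "(u, v) \<in> set (first_edges bs (w + 1))" for u v
    using first_edges_bounds[OF that] by (subst noncrossing_iff) auto
  moreover have "noncrossing (w + 1, w) (u, v)" if "(u, v) \<in> set (first_edges bs (w + 2))" for u v
    using first_edges_bounds[OF that] by (subst noncrossing_iff) auto
  ultimately show ?case using Cons by auto
qed simp

lemma second_edges_noncrossing: "sorted_wrt noncrossing (second_edges bs w)"
proof (induction bs arbitrary: w)
  case (Cons b bs)
  have "noncrossing (w + 2 * length bs + 2, w + 1) (u, v)"
    if "(u, v) \<in> set (second_edges bs (w + 1))" for u v
    using second_edges_bounds[OF that] by (subst noncrossing_iff) auto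
  moreover have "noncrossing (w + 2, w + 1) (u, v)" if "(u, v) \<in> set (second_edges bs (w + 2))" for u v
    using second_edges_bounds[OF that] by (subst noncrossing_iff) auto
  ultimately show ?case using Cons by auto
qed simp

lemma edges_disjoint: "set (first_edges bs w) \<inter> set (second_edges bs w) = {}"
proof (induction bs arbitrary: w)
  case (Cons b bs)
  have first: "(w + 2 * length bs + 2, s) \<notin> set (first_edges bs (w + 1))"
    "(t, w + 1) \<notin> set (first_edges bs (w + 2))" for t s
    using first_edges_bounds by fastforce+
  have second: "(w + 2 * length bs + 2, s) \<notin> set (second_edges bs (w + 1))"
    "(t, w) \<notin> set (second_edges bs (w + 2))" for t s
    using second_edges_bounds by fastforce+
  show ?case
    using Cons.IH[of "w + 1"] Cons.IH[of "w + 2"] first second by (cases b) auto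
qed simp

lemma edges_connected:
  assumes "\<forall>(t, s)\<in>set (first_edges bs w) \<union> set (second_edges bs w). t \<in> J \<longleftrightarrow> s \<in> J"
    and "w \<le> x" "x \<le> w + 2 * length bs"
  shows "x \<in> J \<longleftrightarrow> w \<in> J"
  using assms
proof (induction bs arbitrary: w x)
  case (Cons b bs)
  let ?E = "\<lambda>bs w. set (first_edges bs w) \<union> set (second_edges bs w)"
  have edge: "t \<in> J \<longleftrightarrow> s \<in> J" if "(t, s) \<in> ?E (b # bs) w" for t s
    using Cons.prems(1) that by blast
  have tail: "y \<in> J \<longleftrightarrow> v \<in> J"
    if "?E bs v \<subseteq> ?E (b # bs) w" "v \<le> y" "y \<le> v + 2 * length bs" for v y
    using that(2,3) by (intro Cons.IH) (use Cons.prems(1) that(1) in blast)+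
  show ?case
  proof (cases b)
    case True
    have "w + 2 * length bs + 2 \<in> J \<longleftrightarrow> w \<in> J" "w + 2 * length bs + 2 \<in> J \<longleftrightarrow> w + 1 \<in> J"
      by (rule edge; simp add: True)+
    moreover have "?E bs (w + 1) \<subseteq> ?E (b # bs) w" using True by auto
    moreover have "x = w \<or> x = w + 2 * length bs + 2 \<or> w + 1 \<le> x \<and> x \<le> w + 1 + 2 * length bs"
      using Cons.prems(2,3) by fastforce
    ultimately show ?thesis using tail[of "w + 1" x] by blast
  next
    case False
    have "w + 1 \<in> J \<longleftrightarrow> w \<in> J" "w + 2 \<in> J \<longleftrightarrow> w + 1 \<in> J"
      by (rule edge; simp add: False)+
    moreover have "?E bs (w + 2) \<subseteq> ?E (b # bs) w" using False by auto
    moreover have "x = w \<or> x = w + 1 \<or> w + 2 \<le> x \<and> x \<le> w + 2 + 2 * length bs"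
      using Cons.prems(2,3) by fastforce
    ultimately show ?thesis using tail[of "w + 2" x] by blast
  qed
qed simp

abbreviation shift :: "nat \<times> nat \<Rightarrow> nat \<times> nat" where
  "shift \<equiv> \<lambda>(t, s). (Suc t, Suc s)"

lemma edges_shift:
  "first_edges bs (Suc w) = map shift (first_edges bs w)"
  "second_edges bs (Suc w) = map shift (second_edges bs w)"
  by (induction bs arbitrary: w) auto

lemma midpoints_inj:
  "length bs = length cs \<Longrightarrow> midpoints bs w = midpoints cs w \<Longrightarrow> bs = cs"
proof (induction bs arbitrary: cs w)
  case (Cons b bs)
  then obtain c cs' where "cs = c # cs'" by (cases cs) auto
  then show ?case using Cons by (cases b; cases c) auto
qed simp

text \<open>
  If \<open>f\<close> and \<open>g\<close> swap the ends of the edges of either kind, then applying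
  \<open>f\<close> and \<open>g\<close> in turn walks along the path.
\<close>

lemma midpoints_trace:
  assumes "\<forall>(t, s)\<in>set (first_edges bs w). f t = s \<and> f s = t"
    and "\<forall>(t, s)\<in>set (second_edges bs w). g t = s \<and> g s = t"
    and "k < length bs"
  shows "((f \<circ> g) ^^ k) (f w) = midpoints bs w ! k"
  using assms
proof (induction bs arbitrary: w k)
  case (Cons b bs)
  let ?v = "if b then w + 1 else w + 2"
  have v: "f (g (f w)) = f ?v" and first: "f w = midpoints (b # bs) w ! 0"
    using Cons.prems(1,2) by (auto split: if_splits)
  show ?case
  proof (cases k)
    case 0
    then show ?thesis using first by simp
  next
    case (Suc j)
    have "((f \<circ> g) ^^ Suc j) (f w) = ((f \<circ> g) ^^ j) (f ?v)"
      by (simp only: funpow_Suc_right comp_apply v)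
    also have "\<dots> = midpoints bs ?v ! j"
      using Cons.prems Suc by (intro Cons.IH) (auto split: if_splits)
    also have "\<dots> = midpoints (b # bs) w ! Suc j" by simp
    finally show ?thesis unfolding Suc .
  qed
qed simp

lemma word_perm_fixes_1: "\<forall>(i, e)\<in>set w. 2 \<le> i \<Longrightarrow> word_perm w 1 = 1"
  by (induction w) auto

context braid
begin

section \<open>Straightening a path\<close>

lemma conj_conj_conj:
  "g \<in> B \<Longrightarrow> h \<in> B \<Longrightarrow> x \<in> B \<Longrightarrow> conj_by g (conj_by h x) = conj_by (conj_by g h) (conj_by g x)"
  by (simp add: conj_by_def m_assoc inv_mult_group)

lemma conj_descending_gen:
  assumes "1 \<le> p" "p \<le> i" "Suc i < q" "q \<le> n"
  shows "conj_by (braid_of n (descending_word p q)) (gen (Suc i)) = gen i"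
  using gen_descending_word[of p i q] assms
  by (subst conj_eq_iff) (simp_all add: descending_word_valid)

text \<open>
  The fundamental word of the strands \<open>p, \<dots>, q\<close> rotates the convex hull of these
  punctures.
\<close>

lemma conj_descending_band:
  assumes "1 \<le> p" "p \<le> s" "s < t" "Suc t \<le> q" "q \<le> n"
  shows "conj_by (braid_of n (descending_word p q)) (band n (Suc t) (Suc s)) = band n t s"
  using assms(3)[THEN Suc_leI] assms(4)
proof (induction t rule: dec_induct)
  case base
  then show ?case using assms conj_descending_gen[of p s q] by (simp add: band_base)
next
  case (step t)
  let ?D = "braid_of n (descending_word p q)"
  have "conj_by ?D (band n (Suc (Suc t)) (Suc s)) =
      conj_by ?D (conj_by (gen (Suc t)) (band n (Suc t) (Suc s)))"
    using step assms by (simp add: band_Suc)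
  also have "\<dots> = conj_by (conj_by ?D (gen (Suc t))) (conj_by ?D (band n (Suc t) (Suc s)))"
    using step assms by (intro conj_conj_conj) (auto simp: descending_word_valid)
  also have "\<dots> = conj_by (gen t) (band n t s)"
    using step assms by (simp add: conj_descending_gen)
  also have "\<dots> = band n (Suc t) s" using step assms by (simp add: band_Suc)
  finally show ?case .
qed

lemma conj_bands:
  assumes "g \<in> B" "valid_chords ps" "valid_chords qs"
    "list_all2 (\<lambda>(t, s) (u, v). conj_by g (band n t s) = band n u v) ps qs"
  shows "conj_by g (bands ps) = bands qs"
  using assms(4,2,3)
  by (induction rule: list_all2_induct) (auto simp: conj_mult assms(1))

lemma conj_descending_bands:
  assumes "1 \<le> p" "q \<le> n" "\<forall>(t, s)\<in>set ps. p \<le> s \<and> s < t \<and> Suc t \<le> q"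
  shows "conj_by (braid_of n (descending_word p q)) (bands (map shift ps)) = bands ps"
  using assms
  by (intro conj_bands)
    (fastforce simp: descending_word_valid valid_chord_def list_all2_map1 list_all2_same
      conj_descending_band)+

text \<open>
  The same rotation carries the lowest vertex \<open>w + 1\<close> of its polygon to the highest
  vertex \<open>q\<close>, and drags along the end of an edge that is attached from outside at
  \<open>w\<close>.
\<close>

lemma conj_descending_left:
  assumes "1 \<le> w" "w < q" "q \<le> n"
  shows "conj_by (braid_of n (descending_word (Suc w) q)) (gen w) = band n q w"
  using assms(2)[THEN Suc_leI] assms(3)
proof (induction q rule: dec_induct)
  case base
  then show ?case using assms
    by (simp add: descending_word_def braid_of_Nil band_base conj_by_def)
next
  case (step q)
  have "descending_word (Suc w) (Suc q) = [(q, True)] @ descending_word (Suc w) q"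
    using step by (simp add: descending_word_def)
  then have "braid_of n (descending_word (Suc w) (Suc q)) = gen q \<cdot> braid_of n (descending_word (Suc w) q)"
    unfolding gen_def using step assms by (simp only:) (subst braid_of_append; simp add: descending_word_valid)
  then show ?case
    using step assms by (simp add: conj_conj[symmetric] band_Suc descending_word_valid)
qed

lemma conj_descending_lowest:
  assumes "1 \<le> w" "w < q" "q \<le> n"
  shows "conj_by (braid_of n (descending_word w q)) (gen w) = band n q w"
proof -
  have "descending_word w q = descending_word (Suc w) q @ [(w, True)]"
    using assms by (simp add: descending_word_def upt_conv_Cons)
  then have "braid_of n (descending_word w q) = braid_of n (descending_word (Suc w) q) \<cdot> gen w"
    unfolding gen_def using assms by (simp only:) (subst braid_of_append; simp add: descending_word_valid)
  moreover have "conj_by (gen w) (gen w) = gen w"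
    using assms by (intro conj_comm) (auto simp: comm_def)
  ultimately show ?thesis
    using assms conj_descending_left[of w q] by (simp add: conj_conj[symmetric] descending_word_valid)
qed

lemma edges_valid:
  "1 \<le> w \<Longrightarrow> w + 2 * length bs \<le> n \<Longrightarrow> valid_chords (first_edges bs w)"
  "1 \<le> w \<Longrightarrow> w + 2 * length bs \<le> n \<Longrightarrow> valid_chords (second_edges bs w)"
  using first_edges_bounds second_edges_bounds unfolding valid_chord_def by fastforce+

abbreviation straight :: "nat \<Rightarrow> bool list" where "straight m \<equiv> replicate m False"

text \<open>
  Only the tail of the path beyond \<open>w + 2\<close> is touched by the conjugating braid of the
  induction hypothesis, so it commutes with the first two edges of the straight path. To reach a
  path beginning with the choice \<^const>\<open>True\<close>, rotate the polygon \<open>w + 1,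
  \<dots>, w + 2 * length bs\<close> by one step afterwards.
\<close>

lemma straighten_path:
  assumes "1 \<le> w" "w + 2 * length bs \<le> n"
  shows "\<exists>g. (\<forall>x\<in>set g. w < fst x \<and> fst x < w + 2 * length bs) \<and>
    conj_by (braid_of n g) (bands (first_edges (straight (length bs)) w)) = bands (first_edges bs w) \<and>
    conj_by (braid_of n g) (bands (second_edges (straight (length bs)) w)) = bands (second_edges bs w)"
  using assms
proof (induction bs arbitrary: w)
  case Nil
  then show ?case by (intro exI[of _ "[]"]) (simp add: braid_of_Nil)
next
  case (Cons b bs)
  let ?m = "length bs" and ?q = "w + 2 * length bs + 2"
  obtain g where g: "\<forall>x\<in>set g. w + 2 < fst x \<and> fst x < ?q"
    "conj_by (braid_of n g) (bands (first_edges (straight ?m) (w + 2))) = bands (first_edges bs (w + 2))"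
    "conj_by (braid_of n g) (bands (second_edges (straight ?m) (w + 2))) = bands (second_edges bs (w + 2))"
    using Cons.IH[of "w + 2"] Cons.prems by auto
  have gw: "g \<in> braid_words n" using g(1) Cons.prems by (auto simp: braid_words_def)
  have G: "braid_of n g \<in> B" "gen w \<in> B" "gen (w + 1) \<in> B"
    using gw Cons.prems by auto
  have valid: "valid_chords (first_edges cs (w + 2))" "valid_chords (second_edges cs (w + 2))"
    if "length cs = ?m" for cs
    using edges_valid[of "w + 2" cs] Cons.prems that by simp_all
  have fixed: "conj_by (braid_of n g) (gen w) = gen w" "conj_by (braid_of n g) (gen (w + 1)) = gen (w + 1)"
  proof -
    have "comm (braid_of n g) (gen w)" "comm (braid_of n g) (gen (w + 1))"
      unfolding gen_def using gw g(1) Cons.prems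
      by (intro comm_far_apart; fastforce simp: far_apart_def)+
    then show "conj_by (braid_of n g) (gen w) = gen w" "conj_by (braid_of n g) (gen (w + 1)) = gen (w + 1)"
      using G by (simp_all add: conj_comm)
  qed
  have straight: "bands (first_edges (straight (Suc ?m)) w) = gen w \<cdot> bands (first_edges (straight ?m) (w + 2))"
    "bands (second_edges (straight (Suc ?m)) w) = gen (w + 1) \<cdot> bands (second_edges (straight ?m) (w + 2))"
    using band_base[of w] band_base[of "w + 1"] by simp_all
  have step: "conj_by (braid_of n g) (bands (first_edges (straight (Suc ?m)) w)) =
      gen w \<cdot> bands (first_edges bs (w + 2))"
    "conj_by (braid_of n g) (bands (second_edges (straight (Suc ?m)) w)) =
      gen (w + 1) \<cdot> bands (second_edges bs (w + 2))"
    unfolding straight using G valid[of "straight ?m"] by (simp_all add: conj_mult g(2,3)[simplified] fixed[simplified])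
  show ?case
  proof (cases b)
    case False
    have "gen w \<cdot> bands (first_edges bs (w + 2)) = bands (first_edges (b # bs) w)"
      "gen (w + 1) \<cdot> bands (second_edges bs (w + 2)) = bands (second_edges (b # bs) w)"
      using False band_base[of w] band_base[of "w + 1"] by simp_all
    then show ?thesis using step g(1) by (intro exI[of _ g]) fastforce
  next
    case True
    let ?D = "descending_word (w + 1) ?q"
    have D: "?D \<in> braid_words n" "braid_of n ?D \<in> B"
      using Cons.prems by (simp_all add: descending_word_valid)
    have Dg: "braid_of n (?D @ g) = braid_of n ?D \<cdot> braid_of n g"
      using D(1) gw by (rule braid_of_append)
    have ends: "conj_by (braid_of n ?D) (gen w) = band n ?q w"
      "conj_by (braid_of n ?D) (gen (w + 1)) = band n ?q (w + 1)"
      using Cons.prems conj_descending_left[of w ?q] conj_descending_lowest[of "w + 1" ?q] by simp_all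
    have shifted: "first_edges bs (w + 2) = map shift (first_edges bs (w + 1))"
      "second_edges bs (w + 2) = map shift (second_edges bs (w + 1))"
      using edges_shift[of bs "w + 1"] by simp_all
    have tail: "conj_by (braid_of n ?D) (bands (first_edges bs (w + 2))) = bands (first_edges bs (w + 1))"
      "conj_by (braid_of n ?D) (bands (second_edges bs (w + 2))) = bands (second_edges bs (w + 1))"
      unfolding shifted using Cons.prems
      by (intro conj_descending_bands; force dest: first_edges_bounds second_edges_bounds)+
    have B: "bands (first_edges (straight (Suc ?m)) w) \<in> B" "bands (second_edges (straight (Suc ?m)) w) \<in> B"
      "bands (first_edges bs (w + 2)) \<in> B" "bands (second_edges bs (w + 2)) \<in> B"
      using Cons.prems edges_valid[of w "straight (Suc ?m)"] valid[of bs] bands_closed by simp_all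
    have "conj_by (braid_of n (?D @ g)) (bands (first_edges (straight (Suc ?m)) w)) = bands (first_edges (b # bs) w)"
      "conj_by (braid_of n (?D @ g)) (bands (second_edges (straight (Suc ?m)) w)) = bands (second_edges (b # bs) w)"
      unfolding Dg conj_conj[OF D(2) G(1) B(1), symmetric] conj_conj[OF D(2) G(1) B(2), symmetric] step
      using True D G B by (simp_all add: conj_mult ends[simplified] tail[simplified])
    moreover have "\<forall>x\<in>set (?D @ g). w < fst x \<and> fst x < w + 2 * length (b # bs)"
      using g(1) by (auto simp: descending_word_def)
    ultimately show ?thesis by (intro exI[of _ "?D @ g"]) simp
  qed
qed

section \<open>Reordering the alternating product\<close>

definition step_two_word :: "nat \<Rightarrow> nat \<Rightarrow> braid_word" where
  "step_two_word w m = map (\<lambda>i. (2 * i + w, True)) [0..<m]"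

lemma step_two_word_valid: "1 \<le> w \<Longrightarrow> 2 * m + w \<le> n + 1 \<Longrightarrow> step_two_word w m \<in> braid_words n"
  by (auto simp: step_two_word_def braid_words_def)

lemma step_two_word_Suc_left: "step_two_word w (Suc m) = (w, True) # step_two_word (w + 2) m"
  unfolding step_two_word_def map_upt_Suc by simp

lemma bands_straight:
  assumes "1 \<le> w" "w + 2 * m \<le> n"
  shows "bands (first_edges (straight m) w) = braid_of n (step_two_word w m)"
    and "bands (second_edges (straight m) w) = braid_of n (step_two_word (w + 1) m)"
proof -
  have "bands (first_edges (straight m) w) = braid_of n (step_two_word w m) \<and>
    bands (second_edges (straight m) w) = braid_of n (step_two_word (w + 1) m)"
    using assms
  proof (induction m arbitrary: w)
    case 0
    then show ?case by (simp add: step_two_word_def braid_of_Nil)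
  next
    case (Suc m)
    have IH: "bands (first_edges (straight m) (w + 2)) = braid_of n (step_two_word (w + 2) m)"
      "bands (second_edges (straight m) (w + 2)) = braid_of n (step_two_word (w + 3) m)"
      using Suc.IH[of "w + 2"] Suc.prems by (simp_all add: numeral_3_eq_3)
    have words: "step_two_word (w + 2) m \<in> braid_words n" "step_two_word (w + 3) m \<in> braid_words n"
      using Suc.prems by (auto intro!: step_two_word_valid)
    have "braid_of n (step_two_word w (Suc m)) = gen w \<cdot> braid_of n (step_two_word (w + 2) m)"
      "braid_of n (step_two_word (w + 1) (Suc m)) = gen (w + 1) \<cdot> braid_of n (step_two_word (w + 3) m)"
      unfolding step_two_word_Suc_left gen_def
      using Suc.prems words braid_of_append[of "[(w, True)]" "step_two_word (w + 2) m"]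
        braid_of_append[of "[(w + 1, True)]" "step_two_word (w + 3) m"]
      by (simp_all add: numeral_3_eq_3 numeral_2_eq_2)
    then show ?case
      using IH band_base[of w] band_base[of "w + 1"] by simp
  qed
  then show "bands (first_edges (straight m) w) = braid_of n (step_two_word w m)"
    "bands (second_edges (straight m) w) = braid_of n (step_two_word (w + 1) m)" by auto
qed

definition alternating_word :: "nat \<Rightarrow> braid_word" where
  "alternating_word p = map (\<lambda>i. (i, odd i)) [p..<n]"

lemma alternating_word_valid: "1 \<le> p \<Longrightarrow> alternating_word p \<in> braid_words n"
  by (auto simp: alternating_word_def braid_words_def)

lemma alpha_closed: "alpha n \<in> B"
  unfolding alpha_def using alternating_word_valid[of 1] by (simp add: alternating_word_def)

text \<open>
  One step of the reordering: cyclically move \<open>P M\<close> to the end, then bring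
  \<open>P\<close> and \<open>M\<close> back by commutation to the two sides of \<open>a b\<close>.
  The factors \<open>M\<close> and \<open>a\<close> never pass each other.
\<close>

lemma conjugate_reorder:
  assumes B: "P \<in> B" "M \<in> B" "a \<in> B" "b \<in> B" "R \<in> B"
    and P: "comm P a" "comm P b" "comm P R" and M: "comm M b" "comm M R"
  shows "conjugate (P \<cdot> M \<cdot> (a \<cdot> (b \<cdot> R))) (P \<cdot> a \<cdot> (b \<cdot> M) \<cdot> R)"
proof -
  have "conj_by (\<i> (P \<cdot> M)) (P \<cdot> M \<cdot> (a \<cdot> (b \<cdot> R))) = a \<cdot> (b \<cdot> R) \<cdot> (P \<cdot> M)"
    using B by (simp add: conj_by_def m_assoc inv_mult_group)
  also have "\<dots> = (a \<cdot> (b \<cdot> R)) \<cdot> P \<cdot> M" using B by (simp add: m_assoc)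
  also have "(a \<cdot> (b \<cdot> R)) \<cdot> P = P \<cdot> (a \<cdot> (b \<cdot> R))"
    using comm_mult[OF P(1) comm_mult[OF P(2,3)]] B by (simp add: comm_def)
  also have "P \<cdot> (a \<cdot> (b \<cdot> R)) \<cdot> M = P \<cdot> (a \<cdot> (b \<cdot> (R \<cdot> M)))" using B by (simp add: m_assoc)
  also have "R \<cdot> M = M \<cdot> R" using M(2) by (simp add: comm_def)
  also have "P \<cdot> (a \<cdot> (b \<cdot> (M \<cdot> R))) = P \<cdot> a \<cdot> (b \<cdot> M) \<cdot> R" using B by (simp add: m_assoc)
  finally show ?thesis unfolding conjugate_def using B by (metis inv_closed m_closed)
qed

text \<open>
  All products of the generators with the given signs are conjugate, as for Coxeter elements of a
  tree. Here the odd generators are collected in front and the even ones, which occur inverted,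
  behind them.
\<close>

lemma alpha_conjugate_reordered:
  assumes n: "2 * m + 1 = n" and j: "j \<le> m"
  shows "conjugate (alpha n) (braid_of n (step_two_word 1 j) \<cdot> \<i> (braid_of n (step_two_word 2 j)) \<cdot>
    braid_of n (alternating_word (2 * j + 1)))"
  using j
proof (induction j)
  case 0
  have "conj_by \<e> (alpha n) = alpha n" using alpha_closed by (simp add: conj_by_def)
  then have "conjugate (alpha n) (alpha n)" unfolding conjugate_def by (metis one_closed)
  then show ?case
    using alternating_word_valid[of 1]
    by (simp add: step_two_word_def braid_of_Nil alpha_def alternating_word_def)
next
  case (Suc j)
  let ?Pw = "step_two_word 1 j" and ?Nw = "step_two_word 2 j"
  let ?a = "(2 * j + 1, True)" and ?b = "(2 * j + 2, True)" and ?b' = "(2 * j + 2, False)"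
  let ?Rw = "alternating_word (2 * Suc j + 1)"
  have words: "?Pw \<in> braid_words n" "?Nw \<in> braid_words n" "[?a] \<in> braid_words n"
    "[?b'] \<in> braid_words n" "[?b] \<in> braid_words n" "?Rw \<in> braid_words n"
    using Suc.prems n alternating_word_valid by (simp_all add: step_two_word_valid)
  note B = words[THEN braid_of_closed]
  have "[2 * j + 1..<n] = (2 * j + 1) # (2 * j + 2) # [2 * Suc j + 1..<n]"
    using Suc.prems n by (simp add: upt_conv_Cons)
  then have "alternating_word (2 * j + 1) = [?a] @ [?b'] @ ?Rw"
    by (simp add: alternating_word_def)
  then have R: "braid_of n (alternating_word (2 * j + 1)) =
      braid_of n [?a] \<cdot> (braid_of n [?b'] \<cdot> braid_of n ?Rw)"
    using words by (simp only: braid_of_append braid_words_append)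
  have P: "braid_of n (step_two_word 1 (Suc j)) = braid_of n ?Pw \<cdot> braid_of n [?a]"
    using braid_of_append[OF words(1,3)] by (simp add: step_two_word_def)
  have N: "braid_of n (step_two_word 2 (Suc j)) = braid_of n ?Nw \<cdot> braid_of n [?b]"
    using braid_of_append[OF words(2,5)] by (simp add: step_two_word_def)
  have "braid_of n [?b'] = \<i> (braid_of n [?b])"
    using Suc.prems n braid_of_False[of "2 * j + 2"] by (simp add: gen_def)
  then have N': "\<i> (braid_of n (step_two_word 2 (Suc j))) = braid_of n [?b'] \<cdot> \<i> (braid_of n ?Nw)"
    unfolding N using B by (simp add: inv_mult_group)
  have "conjugate (braid_of n ?Pw \<cdot> \<i> (braid_of n ?Nw) \<cdot>
      (braid_of n [?a] \<cdot> (braid_of n [?b'] \<cdot> braid_of n ?Rw)))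
    (braid_of n ?Pw \<cdot> braid_of n [?a] \<cdot> (braid_of n [?b'] \<cdot> \<i> (braid_of n ?Nw)) \<cdot> braid_of n ?Rw)"
  proof (intro conjugate_reorder)
    show "comm (braid_of n ?Pw) (braid_of n [?a])" "comm (braid_of n ?Pw) (braid_of n [?b'])"
      "comm (braid_of n ?Pw) (braid_of n ?Rw)"
      using words by (auto intro!: comm_far_apart simp: far_apart_def step_two_word_def alternating_word_def)
    have "comm (braid_of n [?b']) (braid_of n ?Nw)" "comm (braid_of n ?Rw) (braid_of n ?Nw)"
      using words by (auto intro!: comm_far_apart simp: far_apart_def step_two_word_def alternating_word_def)
    then show "comm (\<i> (braid_of n ?Nw)) (braid_of n [?b'])" "comm (\<i> (braid_of n ?Nw)) (braid_of n ?Rw)"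
      using B comm_inv comm_sym by blast+
  qed (use B in auto)
  moreover note alpha_closed
  ultimately show ?case
    using conjugate_trans[OF _ Suc.IH] Suc.prems unfolding R P N' by simp
qed

lemma conjugate_conj: "x \<in> B \<Longrightarrow> y \<in> B \<Longrightarrow> g \<in> B \<Longrightarrow> conjugate x y \<Longrightarrow> conjugate x (conj_by g y)"
  using conjugate_trans[of x y "conj_by g y"] unfolding conjugate_def by blast

lemma alpha_conjugate_path:
  assumes n: "2 * m + 1 = n" and bs: "length bs = m"
  shows "conjugate (alpha n) (bands (first_edges bs 1) \<cdot> \<i> (bands (second_edges bs 1)))"
proof -
  let ?P = "\<lambda>bs. bands (first_edges bs 1)" and ?N = "\<lambda>bs. bands (second_edges bs 1)"
  have B: "?P cs \<in> B" "?N cs \<in> B" if "length cs = m" for cs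
    using edges_valid[of 1 cs] n that by simp_all
  have "conjugate (alpha n) (?P (straight m) \<cdot> \<i> (?N (straight m)))"
    using alpha_conjugate_reordered[OF n order.refl] bands_straight[of 1 m] n B[of "straight m"]
    by (simp add: alternating_word_def braid_of_Nil numeral_2_eq_2)
  moreover obtain g where g: "\<forall>x\<in>set g. 1 < fst x \<and> fst x < 1 + 2 * length bs"
    "conj_by (braid_of n g) (?P (straight m)) = ?P bs" "conj_by (braid_of n g) (?N (straight m)) = ?N bs"
    using straighten_path[of 1 bs] n bs by auto
  have "g \<in> braid_words n" using g(1) n bs by (auto simp: braid_words_def)
  then have "braid_of n g \<in> B" by simp
  moreover from this have "conj_by (braid_of n g) (?P (straight m) \<cdot> \<i> (?N (straight m))) = ?P bs \<cdot> \<i> (?N bs)"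
    using B[of "straight m"] g by (simp add: conj_mult conj_inv)
  moreover note alpha_closed
  ultimately show ?thesis
    using conjugate_conj[of "alpha n" "?P (straight m) \<cdot> \<i> (?N (straight m))" "braid_of n g"]
      B[of "straight m"] by simp
qed

section \<open>The braids of the family are distinct\<close>

lemma perm_bands_swap:
  assumes "valid_chords ps" "sorted_wrt noncrossing ps" "(t, s) \<in> set ps"
  shows "perm (bands ps) t = s" "perm (bands ps) s = t"
proof -
  obtain L R where LR: "ps = L @ (t, s) # R" using assms(3) split_list by fastforce
  have v: "valid_chords L" "valid_chords R" "valid_chord (t, s)" using assms by (auto simp: LR)
  have perm: "perm (bands ps) k = perm (bands L) (transpose t s (perm (bands R) k))" for k
    using v by (simp add: LR bands_append perm_mult perm_band valid_chord_def)
  have "noncrossing (t, s) (u, w)" if "(u, w) \<in> set L \<union> set R" for u w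
    using assms(2) that noncrossing_commute[of "(u, w)" "(t, s)"] by (auto simp: LR sorted_wrt_append)
  then have disj: "{t, s} \<inter> {u, w} = {}" if "(u, w) \<in> set L \<union> set R" for u w
    using noncrossing_disjoint that by blast
  have "perm (bands L) k \<in> {k} \<longleftrightarrow> k \<in> {k}" "perm (bands R) k \<in> {k} \<longleftrightarrow> k \<in> {k}" if "k \<in> {t, s}" for k
    using v disj that by (intro perm_bands_invariant; fastforce)+
  then show "perm (bands ps) t = s" "perm (bands ps) s = t"
    by (simp_all add: perm)
qed

text \<open>
  The permutation of \<open>P N\<^sup>-\<^sup>1\<close> follows the path two edges at a time,
  starting at the vertex \<open>1\<close>, which \<open>N\<close> fixes.
\<close>

lemma midpoints_from_perm:
  assumes n: "1 + 2 * length bs \<le> n"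
  shows "midpoints bs 1 = map (\<lambda>k. (perm (bands (first_edges bs 1) \<cdot> \<i> (bands (second_edges bs 1))) ^^ Suc k) 1)
    [0..<length bs]"
proof -
  let ?P = "bands (first_edges bs 1)" and ?N = "bands (second_edges bs 1)"
  have v: "valid_chords (first_edges bs 1)" "valid_chords (second_edges bs 1)"
    using edges_valid[of 1 bs] n by simp_all
  then have B: "?P \<in> B" "?N \<in> B" by simp_all
  have inv: "perm (\<i> ?N) (perm ?N k) = k" for k
    using perm_mult[of "\<i> ?N" ?N] B by (simp add: fun_eq_iff)
  have P: "\<forall>(t, s)\<in>set (first_edges bs 1). perm ?P t = s \<and> perm ?P s = t"
    using perm_bands_swap[OF v(1) first_edges_noncrossing] by blast
  have N: "\<forall>(t, s)\<in>set (second_edges bs 1). perm (\<i> ?N) t = s \<and> perm (\<i> ?N) s = t"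
    using perm_bands_swap[OF v(2) second_edges_noncrossing] inv by fastforce
  have "perm ?N 1 \<in> {1} \<longleftrightarrow> 1 \<in> {1::nat}"
    using v by (intro perm_bands_invariant) (auto dest: second_edges_bounds)
  then have one: "perm (\<i> ?N) 1 = 1" using inv[of 1] by simp
  have "((perm (?P \<cdot> \<i> ?N)) ^^ Suc k) 1 = midpoints bs 1 ! k" if "k < length bs" for k
    using midpoints_trace[OF P N that] B one
    by (simp add: perm_mult funpow_Suc_right del: funpow.simps)
  then show ?thesis by (intro nth_equalityI) auto
qed

text \<open>
  The conjugate \<open>\<delta>\<^sup>-\<^sup>1 (P N\<^sup>-\<^sup>1) \<delta>\<close>, written as
  its left normal form.
\<close>

definition path_braid :: "bool list \<Rightarrow> braid" where
  "path_braid bs = normal_form_value n (- 1)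
    [bands (first_edges bs 1), star (bands (second_edges bs 1))]"

lemma path_braid_conj:
  assumes "1 + 2 * length bs \<le> n"
  shows "path_braid bs = tau (bands (first_edges bs 1) \<cdot> \<i> (bands (second_edges bs 1)))"
  using edges_valid[of 1 bs] assms
  by (simp add: path_braid_def normal_form_value_def delta_int_pow tau_def conj_by_def star_def m_assoc)

lemma path_braid_inj:
  assumes "2 * m + 1 = n"
  shows "inj_on path_braid {bs. length bs = m}"
proof (rule inj_onI, clarify)
  fix bs cs :: "bool list"
  assume m: "m = length bs" "length cs = length bs" and eq: "path_braid bs = path_braid cs"
  let ?x = "\<lambda>bs. bands (first_edges bs 1) \<cdot> \<i> (bands (second_edges bs 1))"
  have B: "?x cs \<in> B" if "length cs = m" for cs
    using edges_valid[of 1 cs] assms that by simp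
  have "tau (?x bs) = tau (?x cs)" using eq path_braid_conj m assms by simp
  then have "?x bs = ?x cs" using tau_inj B m by simp
  moreover have "1 + 2 * length bs \<le> n" "1 + 2 * length cs \<le> n" using m assms by simp_all
  ultimately have "midpoints bs 1 = midpoints cs 1"
    by (simp only: midpoints_from_perm m(2))
  with m(2)[symmetric] show "bs = cs" by (rule midpoints_inj)
qed

text \<open>
  A common band divisor of \<open>N\<close> and \<open>P\<close> would be a common edge. A common
  band divisor \<open>(j l)\<close> of the complements would make the interval
  \<open>{l..<j}\<close> closed under all edges; it contains \<open>l\<close> but not
  \<open>j\<close>, although the path connects them.
\<close>

lemma path_left_weighted:
  assumes n: "2 * m + 1 = n" and m: "1 \<le> m" and bs: "length bs = m"
  defines "P \<equiv> bands (first_edges bs 1)" and "N \<equiv> bands (second_edges bs 1)"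
  shows "left_weighted P (star N)" "left_weighted (star N) (tau P)"
proof -
  have v: "valid_chords (first_edges bs 1)" "valid_chords (second_edges bs 1)"
    using edges_valid[of 1 bs] n bs by simp_all
  note nc = first_edges_noncrossing[of bs 1] second_edges_noncrossing[of bs 1]
  have CF: "P \<in> CF" "N \<in> CF" unfolding P_def N_def
    using noncrossing_bands_canonical v nc by blast+
  then have B: "P \<in> B" "N \<in> B" by simp_all
  have "expo P = int m" "expo N = int m"
    unfolding P_def N_def using expo_bands v bs by simp_all
  then have ex: "expo P = int m" "expo (star N) = int m" "expo (tau P) = int m"
    using n B by (simp_all add: expo_star expo_tau)
  have "int n = 2 * int m + 1" using n by linarith
  then have "expo X \<noteq> expo \<e>" "expo X \<noteq> expo \<delta>" if "expo X = int m" for X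
    using that m by (simp_all add: expo_delta)
  then have nontriv: "X \<in> CF - {\<e>, \<delta>}" if "X \<in> CF" "expo X = int m" for X
    using that by blast
  have "no_common_divisor N P"
    unfolding no_common_divisor_def
  proof clarify
    fix t s assume ts: "valid_chord (t, s)" "\<i> (band n t s) \<cdot> N \<in> CF" "\<i> (band n t s) \<cdot> P \<in> CF"
    have "(t, s) \<in> set (first_edges bs 1)" "(t, s) \<in> set (second_edges bs 1)"
      using divisor_of_noncrossing_bands[OF v(1) nc(1) ts(1)] ts(3)
        divisor_of_noncrossing_bands[OF v(2) nc(2) ts(1)] ts(2)
      unfolding P_def N_def by blast+
    then show False using edges_disjoint[of bs 1] by blast
  qed
  then have 1: "no_common_divisor (star (star N)) (tau P)"
    using no_common_divisor_tau B by (simp add: star_star)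
  have 2: "no_common_divisor (star P) (star N)"
    unfolding no_common_divisor_def
  proof clarify
    fix j l assume jl: "valid_chord (j, l)" "\<i> (band n j l) \<cdot> star P \<in> CF"
      "\<i> (band n j l) \<cdot> star N \<in> CF"
    have closed: "\<forall>(t, s)\<in>set (first_edges bs 1) \<union> set (second_edges bs 1). t \<in> {l..<j} \<longleftrightarrow> s \<in> {l..<j}"
      using divisor_of_complement[OF v(1) nc(1) jl(1)] jl(2)
        divisor_of_complement[OF v(2) nc(2) jl(1)] jl(3)
      unfolding P_def N_def by blast
    have "1 \<le> l" "l < j" "j \<le> n" using jl(1) by (auto simp: valid_chord_def)
    then have "j \<in> {l..<j} \<longleftrightarrow> 1 \<in> {l..<j}" "l \<in> {l..<j} \<longleftrightarrow> 1 \<in> {l..<j}"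
      using edges_connected[OF closed, of j] edges_connected[OF closed, of l] n bs by simp_all
    then show False using \<open>l < j\<close> by simp
  qed
  show "left_weighted P (star N)" "left_weighted (star N) (tau P)"
    unfolding left_weighted_def using nontriv CF star_canonical tau_canonical ex 1 2 by blast+
qed

lemma alpha_nontrivial: "alpha n \<noteq> \<e>"
proof
  assume "alpha n = \<e>"
  then have id: "perm (alpha n) = id" by simp
  have "alpha n = braid_of n (alternating_word 1)" by (simp add: alpha_def alternating_word_def)
  then have "perm (alpha n) = word_perm (alternating_word 1)"
    using alternating_word_valid[of 1] by (simp add: braid_of_invariants)
  moreover have "alternating_word 1 = (1, True) # alternating_word 2"
    using n_ge_2 by (simp add: alternating_word_def upt_conv_Cons numeral_2_eq_2)
  moreover have "word_perm (alternating_word 2) 1 = 1"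
    by (rule word_perm_fixes_1) (auto simp: alternating_word_def)
  ultimately have "perm (alpha n) 1 = 2" by simp
  then show False using id by simp
qed

lemma path_braid_rigid_ultra_summit:
  assumes n: "2 * m + 1 = n" and m: "1 \<le> m" and bs: "length bs = m"
  shows "path_braid bs \<in> {x \<in> ultra_summit_set n (alpha n). rigid n x}"
proof -
  let ?P = "bands (first_edges bs 1)" and ?N = "bands (second_edges bs 1)"
  have v: "valid_chords (first_edges bs 1)" "valid_chords (second_edges bs 1)"
    using edges_valid[of 1 bs] n bs by simp_all
  have PN: "conjugate (alpha n) (?P \<cdot> \<i> ?N)" by (rule alpha_conjugate_path[OF n bs])
  have pb: "path_braid bs = conj_by (\<i> \<delta>) (?P \<cdot> \<i> ?N)"
    using path_braid_conj[of bs] n bs by (simp add: tau_def)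
  then have c: "conjugate (alpha n) (path_braid bs)"
    using conjugate_conj[OF alpha_closed _ _ PN] v by simp
  obtain g where g: "g \<in> B" "?P \<cdot> \<i> ?N = conj_by g (alpha n)"
    using PN unfolding conjugate_def by blast
  have "expo (alpha n) = expo (?P \<cdot> \<i> ?N)" using g alpha_closed by (simp add: expo_conj)
  also have "\<dots> = 0" using v by (simp add: expo_mult expo_inv expo_bands)
  finally show ?thesis
    using ultra_summit_rigid[OF alpha_closed _ alpha_nontrivial path_left_weighted[OF assms]] c
    unfolding path_braid_def by blast
qed

end

section \<open>Rigid braids in the ultra summit set\<close>

theorem theorem2:
  fixes n :: nat
  assumes "n \<ge> 3" and "odd n"
  shows "\<exists>S. S \<subseteq> {x \<in> ultra_summit_set n (alpha n). rigid n x} \<and>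
    finite S \<and> card S \<ge> 2 ^ ((n - 1) div 2)"
proof -
  interpret braid n using assms(1) by unfold_locales simp
  define m where "m = (n - 1) div 2"
  have n: "2 * m + 1 = n" and m: "1 \<le> m" using assms by (auto simp: m_def elim!: oddE)
  let ?L = "{bs :: bool list. length bs = m}"
  have fin: "finite ?L" and card: "card ?L = 2 ^ m"
    using finite_lists_length_eq[of "UNIV :: bool set" m] card_lists_length_eq[of "UNIV :: bool set" m]
    by (simp_all add: card_UNIV_bool)
  have "path_braid ` ?L \<subseteq> {x \<in> ultra_summit_set n (alpha n). rigid n x}"
    using path_braid_rigid_ultra_summit[OF n m] by blast
  moreover have "finite (path_braid ` ?L)" using fin by simp
  moreover have "card (path_braid ` ?L) = 2 ^ m"
    using card_image[OF path_braid_inj[OF n]] card by simp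
  ultimately show ?thesis
    by (intro exI[of _ "path_braid ` ?L"]) (simp add: m_def)
qed

end
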